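(* Let $I\subset\mathbb{R}$ be a nonempty open interval. For all real $\lambda$ with $\frac12\le\lambda\le\frac35$ one has $$\dim S_3(I,\lambda)\le\frac{4-2\lambda}{3(1+\lambda)}.$$
   Context: $\dim$ denotes Hausdorff dimension, and $\|y\|$ denotes the distance from $y\in\mathbb{R}$ to the nearest integer. For $x\in\mathbb{R}$, $\lambda_3(x)\in[0,+\infty]$ is the supremum of all real $\lambda$ such that the inequality $\max_{1\le i\le 3}\|qx^i\|\le q^{-\lambda}$ has infinitely many positive integer solutions $q$. For an open interval $I\subset\mathbb{R}$, $S_3(I,\lambda):=\{x\in I:\lambda_3(x)>\lambda\}$. *)

theory Defs
  imports "HOL-Analysis.Analysis"
begin

(* With 0 powr s = 0 for every s, the case split realises the usual conventions
   diam(U)^0 = 1 for nonempty U and diam({})^s = 0. *)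
definition diam_powr :: "real \<Rightarrow> 'a::metric_space set \<Rightarrow> real" where
  "diam_powr s U = (if U = {} then 0 else if s = 0 then 1 else diameter U powr s)"

(* Boundedness of the covering sets is required explicitly because the library's diameter
   is only meaningful on bounded sets.  Finite covers are included by padding with {}. *)
definition hausdorff_content :: "real \<Rightarrow> real \<Rightarrow> 'a::metric_space set \<Rightarrow> ennreal" where
  "hausdorff_content s \<delta> A =
     (INF U \<in> {U :: nat \<Rightarrow> 'a set.
                 A \<subseteq> (\<Union>i. U i) \<and> (\<forall>i. bounded (U i) \<and> diameter (U i) \<le> \<delta>)}.
        \<Sum>i. ennreal (diam_powr s (U i)))"

definition hausdorff_measure :: "real \<Rightarrow> 'a::metric_space set \<Rightarrow> ennreal" where
  "hausdorff_measure s A = (SUP \<delta> \<in> {0<..}. hausdorff_content s \<delta> A)"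

(* The infimum of the empty set is \<infinity>; the empty set gets dimension 0. *)
definition hausdorff_dim :: "'a::metric_space set \<Rightarrow> ennreal" where
  "hausdorff_dim A = (INF s \<in> {s :: real. 0 \<le> s \<and> hausdorff_measure s A = 0}. ennreal s)"

definition dist_nearest_int :: "real \<Rightarrow> real" where
  "dist_nearest_int y = infdist y \<int>"

definition lambda_exponent :: "nat \<Rightarrow> real \<Rightarrow> ereal" where
  "lambda_exponent n x =
     (SUP l \<in> {l :: real. infinite {q :: nat. q > 0 \<and>
                 Max ((\<lambda>i. dist_nearest_int (real q * x ^ i)) ` {1..n}) \<le> real q powr (- l)}}.
        ereal l)"

definition S_set :: "nat \<Rightarrow> real set \<Rightarrow> real \<Rightarrow> real set" where
  "S_set n I l = {x \<in> I. lambda_exponent n x > ereal l}"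

end

theory Submission
  imports Defs
begin

text \<open>
  An integer point (q, p1, p2, p3) with p_i close to q x^i is read as the binary cubic form
  q X^3 + 3 p1 X^2 Y + 3 p2 X Y^2 + p3 Y^3.  Its Hessian has coefficients of size at most
  q^(1 - l), so its discriminant D is an integer of size at most 5 q^(2 - 2 l), and the syzygy
  G^2 + 4 A^3 = q^2 D excludes D < 0 for large q.

  If D = 0, the repeated root of the form is a rational b / a with
  |x - b / a| \<le> 2 a^(-(1 + l) / (1 - l)), and the easy half of Jarnik's theorem applies.

  If D > 0, the form is a sum of two cubes of real linear forms, whose values on Z^2 form a lattice
  of covolume D^(1/6).  Reducing this lattice gives an equivalent form c out of a set over which
  D^(-1 - e) is summable.  For a given c the point is determined, up to an integer translation of x,
  by the primitive vector (m, n) that the substitution sends to (1, 0).  At (m, n) the Hessian is at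
  most H = (2 Q)^(1 - l), which confines (m, n) to two thin sectors and leaves O(H / D^(1/2)) choices.
  Summing over c leaves O(Q^((1 - l) (2 + 2 e))) points with q between Q and 2 Q.

  Both cases give dimension at most (2 - 2 l) / (1 + l), which does not exceed the stated bound when
  l \<ge> 1/2.
\<close>

section \<open>Hausdorff null sets\<close>

text \<open>The coefficients are weighted 1, 3, 3, 1 so that an exact point q (1, x, x^2, x^3)
  becomes the perfect cube q (X + x Y)^3, whose Hessian vanishes; this is why a good approximation
  gives a form with small invariants. The counting for D > 0 balances because D <= 5 H^2: it turns H
  / D^(1/2) into O(H^(2 + 2 e) D^(-1 - e)), exactly the weight that can be summed over reduced
  forms. With H of order Q^(1 - l) and intervals of length of order Q^(-(1 + l)), the sum over
  dyadic Q converges once s (1 + l) > (1 - l) (2 + 2 e), and e is arbitrary. For D = 0 there is no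
  pair of independent linear forms, and many q can share one repeated root; there the roots are
  counted by their denominators instead. Their approximation exponent w = (1 + l) / (1 - l) gives
  dimension 2 / w, which is the same threshold (2 - 2 l) / (1 + l).\<close>

definition hausdorff_null :: "real \<Rightarrow> 'a::metric_space set \<Rightarrow> bool" where
  "hausdorff_null s A \<longleftrightarrow> (\<forall>e>0. \<exists>U :: nat \<Rightarrow> 'a set. A \<subseteq> (\<Union>i. U i) \<and>
     (\<forall>i. bounded (U i)) \<and> (\<Sum>i. ennreal (diam_powr s (U i))) \<le> ennreal e)"

lemma hausdorff_null_subset: "hausdorff_null s B \<Longrightarrow> A \<subseteq> B \<Longrightarrow> hausdorff_null s A"
  unfolding hausdorff_null_def by (meson order_trans)

text \<open>\<open>hausdorff_null\<close> carries no mesh size because positive \<open>s\<close>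
  supplies one: if the whole sum is at most d^s, then so is each term, and every diameter is at most
  d.\<close>

lemma hausdorff_measure_eq_0:
  assumes "s > 0" and null: "hausdorff_null s A"
  shows "hausdorff_measure s A = 0"
proof -
  have "hausdorff_content s d A = 0" if "d > 0" for d
  proof -
    have "hausdorff_content s d A \<le> 0 + ennreal e" if "e > 0" for e :: real
    proof -
      have "min e (d powr s) > 0" using \<open>e > 0\<close> \<open>d > 0\<close> by simp
      then obtain U where U: "A \<subseteq> (\<Union>i. U i)" "\<And>i. bounded (U i)"
        and sum: "(\<Sum>i. ennreal (diam_powr s (U i))) \<le> ennreal (min e (d powr s))"
        using null unfolding hausdorff_null_def by metis
      have "diameter (U i) \<le> d" for i
      proof (cases "U i = {}")
        case True
        then show ?thesis using \<open>d > 0\<close> by simp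
      next
        case False
        have "ennreal (diam_powr s (U i)) \<le> (\<Sum>i. ennreal (diam_powr s (U i)))"
          using sum_le_suminf[of "\<lambda>i. ennreal (diam_powr s (U i))" "{i}"] by simp
        also note sum
        finally have "diam_powr s (U i) \<le> min e (d powr s)"
          using \<open>min e (d powr s) > 0\<close> by (subst (asm) ennreal_le_iff) simp_all
        then have "diameter (U i) powr s \<le> d powr s"
          using False \<open>s > 0\<close> by (simp add: diam_powr_def)
        then show ?thesis
          using \<open>s > 0\<close> \<open>d > 0\<close> powr_less_mono2[of s d "diameter (U i)"] by force
      qed
      then have "hausdorff_content s d A \<le> (\<Sum>i. ennreal (diam_powr s (U i)))"
        unfolding hausdorff_content_def using U by (intro INF_lower) auto
      also have "\<dots> \<le> ennreal e"
        using sum by (rule order_trans) (simp add: ennreal_leI)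
      finally show ?thesis by simp
    qed
    then have "hausdorff_content s d A \<le> 0"
      by (rule ennreal_le_epsilon)
    then show ?thesis by simp
  qed
  then show ?thesis
    unfolding hausdorff_measure_def by (simp add: SUP_eq_const)
qed

lemma hausdorff_null_UN:
  fixes A :: "nat \<Rightarrow> 'a::metric_space set"
  assumes "\<And>n. hausdorff_null s (A n)"
  shows "hausdorff_null s (\<Union>n. A n)"
  unfolding hausdorff_null_def
proof (intro allI impI)
  fix e :: real assume "e > 0"
  have "\<exists>U :: nat \<Rightarrow> 'a set. A n \<subseteq> (\<Union>i. U i) \<and> (\<forall>i. bounded (U i)) \<and>
      (\<Sum>i. ennreal (diam_powr s (U i))) \<le> ennreal (e * (1/2) ^ Suc n)" for n
  proof -
    have "e * (1/2) ^ Suc n > 0" using \<open>e > 0\<close> by simp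
    then show ?thesis using assms[of n] unfolding hausdorff_null_def by blast
  qed
  then obtain U :: "nat \<Rightarrow> nat \<Rightarrow> 'a set" where U: "\<And>n. A n \<subseteq> (\<Union>i. U n i)" "\<And>n i. bounded (U n i)"
    "\<And>n. (\<Sum>i. ennreal (diam_powr s (U n i))) \<le> ennreal (e * (1/2) ^ Suc n)"
    by metis
  define V where "V = (\<lambda>i. case prod_decode i of (n, j) \<Rightarrow> U n j)"
  have "(\<Sum>i. ennreal (diam_powr s (V i))) =
      (\<Sum>i. (\<lambda>(n, j). ennreal (diam_powr s (U n j))) (prod_decode i))"
    by (simp add: V_def case_prod_unfold)
  also have "\<dots> = (\<Sum>n. \<Sum>j. ennreal (diam_powr s (U n j)))"
    by (rule suminf_ennreal_2dimen) simp
  also have "\<dots> \<le> (\<Sum>n. ennreal (e * (1/2) ^ Suc n))"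
    by (intro suminf_le U) auto
  also have "\<dots> = ennreal e"
  proof -
    have "(\<lambda>n. e * (1/2) ^ Suc n) sums (e * 1)"
      by (intro sums_mult power_half_series)
    then show ?thesis using \<open>e > 0\<close> by (intro suminf_ennreal_eq) auto
  qed
  finally have "(\<Sum>i. ennreal (diam_powr s (V i))) \<le> ennreal e" .
  moreover have "(\<Union>n. A n) \<subseteq> (\<Union>i. V i)"
  proof
    fix x assume "x \<in> (\<Union>n. A n)"
    then obtain n j where "x \<in> U n j" using U(1) by blast
    then have "x \<in> V (prod_encode (n, j))" by (simp add: V_def)
    then show "x \<in> (\<Union>i. V i)" by blast
  qed
  moreover have "\<forall>i. bounded (V i)"
    by (simp add: V_def U(2) case_prod_unfold)
  ultimately show "\<exists>U. (\<Union>n. A n) \<subseteq> (\<Union>i. U i) \<and> (\<forall>i. bounded (U i)) \<and>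
      (\<Sum>i. ennreal (diam_powr s (U i))) \<le> ennreal e" by blast
qed

lemma hausdorff_null_Un:
  assumes "hausdorff_null s A" "hausdorff_null s B"
  shows "hausdorff_null s (A \<union> B)"
proof -
  have "hausdorff_null s (\<Union>n::nat. if n = 0 then A else B)"
    by (rule hausdorff_null_UN) (use assms in auto)
  then show ?thesis
    by (rule hausdorff_null_subset) (auto split: if_splits)
qed

text \<open>Convergence half of Borel-Cantelli: the balls of all levels from \<open>N\<close> on
  cover the limsup set, and their total cost is a tail of a convergent series.\<close>

lemma hausdorff_cantelli:
  fixes F :: "nat \<Rightarrow> 'a::metric_space set" and d :: "nat \<Rightarrow> real"
  assumes "s > 0" and fin: "\<And>k. finite (F k)" and d: "\<And>k. 0 \<le> d k"
    and summ: "summable (\<lambda>k. real (card (F k)) * (2 * d k) powr s)"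
  shows "hausdorff_null s {x. infinite {k. \<exists>a\<in>F k. dist x a \<le> d k}}"
  unfolding hausdorff_null_def
proof (intro allI impI)
  fix e :: real assume "e > 0"
  let ?f = "\<lambda>k. real (card (F k)) * (2 * d k) powr s"
  obtain N where N: "norm (\<Sum>i. ?f (i + N)) < e"
    using suminf_exist_split[OF \<open>e > 0\<close> summ] by auto
  have "\<exists>h. bij_betw h {..<card (F k)} (F k)" for k
    using ex_bij_betw_nat_finite[OF fin[of k]] by (simp add: atLeast0LessThan)
  then obtain h where h: "\<And>k. bij_betw (h k) {..<card (F k)} (F k)" by metis
  \<comment> \<open>Each level is padded with empty sets, which cost 0 by the convention in
    \<open>diam_powr\<close>.\<close>
  define U where "U = (\<lambda>n j. if j < card (F (n + N)) then cball (h (n + N) j) (d (n + N)) else {})"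
  define V where "V = (\<lambda>i. case prod_decode i of (n, j) \<Rightarrow> U n j)"
  have row: "(\<Sum>j. ennreal (diam_powr s (U n j))) \<le> ennreal (?f (n + N))" for n
  proof -
    have "(\<Sum>j. ennreal (diam_powr s (U n j))) = (\<Sum>j<card (F (n + N)). ennreal (diam_powr s (U n j)))"
      by (rule suminf_finite) (auto simp: U_def diam_powr_def)
    also have "\<dots> \<le> (\<Sum>j<card (F (n + N)). ennreal ((2 * d (n + N)) powr s))"
    proof (rule sum_mono)
      fix j assume "j \<in> {..<card (F (n + N))}"
      have "diameter (cball c (d (n + N))) \<le> 2 * d (n + N)" for c :: 'a
      proof -
        have "dist x y \<le> 2 * d (n + N)" if "x \<in> cball c (d (n + N))" "y \<in> cball c (d (n + N))" for x y
          using that dist_triangle2[of x y c] by (simp add: dist_commute)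
        moreover have "cball c (d (n + N)) \<noteq> {}" using d by (simp add: linorder_not_less)
        ultimately show ?thesis
          unfolding diameter_def by (auto intro!: cSUP_least)
      qed
      then show "ennreal (diam_powr s (U n j)) \<le> ennreal ((2 * d (n + N)) powr s)"
        using \<open>s > 0\<close> by (auto simp: U_def diam_powr_def diameter_ge_0 intro!: ennreal_leI powr_mono2)
    qed
    also have "\<dots> = ennreal (?f (n + N))"
      by (simp add: ennreal_mult ennreal_of_nat_eq_real_of_nat)
    finally show ?thesis .
  qed
  have "(\<Sum>i. ennreal (diam_powr s (V i))) =
      (\<Sum>i. (\<lambda>(n, j). ennreal (diam_powr s (U n j))) (prod_decode i))"
    by (simp add: V_def case_prod_unfold)
  also have "\<dots> = (\<Sum>n. \<Sum>j. ennreal (diam_powr s (U n j)))"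
    by (rule suminf_ennreal_2dimen) simp
  also have "\<dots> \<le> (\<Sum>n. ennreal (?f (n + N)))"
    by (intro suminf_le row) auto
  also have "\<dots> = ennreal (\<Sum>n. ?f (n + N))"
    using summable_ignore_initial_segment[OF summ, of N] by (intro suminf_ennreal2) auto
  also have "\<dots> \<le> ennreal e" using N by (intro ennreal_leI) auto
  finally have "(\<Sum>i. ennreal (diam_powr s (V i))) \<le> ennreal e" .
  moreover have "{x. infinite {k. \<exists>a\<in>F k. dist x a \<le> d k}} \<subseteq> (\<Union>i. V i)"
  proof
    fix x assume "x \<in> {x. infinite {k. \<exists>a\<in>F k. dist x a \<le> d k}}"
    then obtain k a where k: "k \<ge> N" "a \<in> F k" "dist x a \<le> d k"
      unfolding infinite_nat_iff_unbounded_le by blast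
    then obtain j where "j < card (F k)" "h k j = a"
      using h[of k] unfolding bij_betw_def by (metis imageE lessThan_iff)
    then have "x \<in> U (k - N) j" using k by (simp add: U_def dist_commute)
    then have "x \<in> V (prod_encode (k - N, j))" by (simp add: V_def)
    then show "x \<in> (\<Union>i. V i)" by blast
  qed
  moreover have "\<forall>i. bounded (V i)"
    by (simp add: V_def U_def case_prod_unfold)
  ultimately show "\<exists>U. {x. infinite {k. \<exists>a\<in>F k. dist x a \<le> d k}} \<subseteq> (\<Union>i. U i) \<and>
      (\<forall>i. bounded (U i)) \<and> (\<Sum>i. ennreal (diam_powr s (U i))) \<le> ennreal e" by blast
qed

lemma hausdorff_dim_le:
  assumes "t \<ge> 0" "\<And>s. s > t \<Longrightarrow> hausdorff_null s A"
  shows "hausdorff_dim A \<le> ennreal t"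
proof (rule ennreal_le_epsilon)
  fix e :: real assume "e > 0"
  have "hausdorff_dim A \<le> ennreal (t + e)"
    unfolding hausdorff_dim_def using assms \<open>e > 0\<close> hausdorff_measure_eq_0[of "t + e" A]
    by (intro INF_lower) auto
  then show "hausdorff_dim A \<le> ennreal t + ennreal e"
    using assms \<open>e > 0\<close> by (simp add: ennreal_plus)
qed

section \<open>Binary cubic forms\<close>

type_synonym cubic = "int \<times> int \<times> int \<times> int"

text \<open>For the form f with these coefficients this is f(a X + c Y, b X + d Y): (a, b) is the
  image of (1, 0) and (c, d) that of (0, 1).\<close>

fun subst_cubic :: "cubic \<Rightarrow> int \<Rightarrow> int \<Rightarrow> int \<Rightarrow> int \<Rightarrow> cubic" where
  "subst_cubic (p0, p1, p2, p3) a b c d =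
    (p0 * a^3 + 3 * p1 * a^2 * b + 3 * p2 * a * b^2 + p3 * b^3,
     p0 * a^2 * c + p1 * (a^2 * d + 2 * a * b * c) + p2 * (2 * a * b * d + b^2 * c) + p3 * b^2 * d,
     p0 * a * c^2 + p1 * (2 * a * c * d + b * c^2) + p2 * (a * d^2 + 2 * b * c * d) + p3 * b * d^2,
     p0 * c^3 + 3 * p1 * c^2 * d + 3 * p2 * c * d^2 + p3 * d^3)"

text \<open>Up to a constant factor, the value of the Hessian covariant at (1, 0). Its value at
  another primitive vector is obtained by first substituting that vector for (1, 0).\<close>

fun hess :: "cubic \<Rightarrow> int" where
  "hess (p0, p1, p2, p3) = p0 * p2 - p1^2"

text \<open>Discriminant of the quadratic Hessian, which is -1/27 times the usual discriminant of
  the cubic; so a positive value means a single real root, as for X^3 + Y^3.\<close>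

fun disc :: "cubic \<Rightarrow> int" where
  "disc (p0, p1, p2, p3) = (p0 * p3 - p1 * p2)^2 - 4 * (p0 * p2 - p1^2) * (p1 * p3 - p2^2)"

text \<open>Coefficients of (x0 X + x1 Y)^3 + (y0 X + y1 Y)^3.\<close>

fun sum_of_cubes :: "cubic \<Rightarrow> real \<Rightarrow> real \<Rightarrow> real \<Rightarrow> real \<Rightarrow> bool" where
  "sum_of_cubes (p0, p1, p2, p3) x0 x1 y0 y1 \<longleftrightarrow>
     real_of_int p0 = x0^3 + y0^3 \<and> real_of_int p1 = x0^2 * x1 + y0^2 * y1 \<and>
     real_of_int p2 = x0 * x1^2 + y0 * y1^2 \<and> real_of_int p3 = x1^3 + y1^3"

lemma subst_cubic_subst_cubic:
  "subst_cubic (subst_cubic p a b c d) e f g h =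
   subst_cubic p (e * a + f * c) (e * b + f * d) (g * a + h * c) (g * b + h * d)"
  by (cases p) (simp add: algebra_simps power2_eq_square power3_eq_cube)

lemma subst_cubic_inverse:
  assumes "a * d - b * c = 1"
  shows "subst_cubic (subst_cubic p a b c d) d (- b) (- c) a = p"
proof -
  have "d * a - b * c = 1" "d * b - b * d = 0" "a * c - c * a = 0" "a * d - c * b = 1"
    using assms by (simp_all add: algebra_simps)
  then show ?thesis
    by (cases p) (simp add: subst_cubic_subst_cubic algebra_simps del: subst_cubic.simps, simp add: algebra_simps)
qed

lemma sum_of_cubes_subst:
  assumes "sum_of_cubes p x0 x1 y0 y1"
  shows "sum_of_cubes (subst_cubic p a b c d) (a * x0 + b * x1) (c * x0 + d * x1) (a * y0 + b * y1) (c * y0 + d * y1)"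
  using assms
  by (cases p) (simp add: algebra_simps power2_eq_square power3_eq_cube)

text \<open>Every Hessian coefficient contains the square of x0 y1 - x1 y0; what remains is (x0 y1 +
  x1 y0)^2 - 4 x0 x1 y0 y1, which is that square once more.\<close>

lemma disc_sum_of_cubes:
  assumes "sum_of_cubes p x0 x1 y0 y1"
  shows "real_of_int (disc p) = (x0 * y1 - x1 * y0) ^ 6"
proof -
  obtain p0 p1 p2 p3 where p: "p = (p0, p1, p2, p3)" by (cases p)
  have "p0 * p3 - p1 * p2 = (x0 * y1 - x1 * y0) ^ 2 * (x0 * y1 + x1 * y0)"
    and "p0 * p2 - p1^2 = (x0 * y1 - x1 * y0) ^ 2 * (x0 * y0)"
    and "p1 * p3 - p2^2 = (x0 * y1 - x1 * y0) ^ 2 * (x1 * y1)"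
    using assms by (simp_all add: p algebra_simps power2_eq_square power3_eq_cube)
  then have "real_of_int (disc p) = ((x0 * y1 - x1 * y0) ^ 2 * (x0 * y1 + x1 * y0))^2 -
     4 * ((x0 * y1 - x1 * y0) ^ 2 * (x0 * y0)) * ((x0 * y1 - x1 * y0) ^ 2 * (x1 * y1))"
    by (simp add: p)
  also have "\<dots> = (x0 * y1 - x1 * y0) ^ 6" by algebra
  finally show ?thesis .
qed

text \<open>The Hessian is a multiple of the product of the two linear forms, so bounding it
  confines a vector to the neighbourhood of their zero lines.\<close>

lemma hess_sum_of_cubes:
  assumes "sum_of_cubes p x0 x1 y0 y1"
  shows "real_of_int (hess p) = (x0 * y1 - x1 * y0) ^ 2 * (x0 * y0)"
proof (cases p)
  case (fields p0 p1 p2 p3)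
  show ?thesis using assms by (simp add: fields algebra_simps power2_eq_square power3_eq_cube)
qed

text \<open>The relation G^2 + 4 A^3 = D f^2 between the covariants, read at (1, 0). D < 0 will
  contradict a small A, D > 0 yields the two cube roots, and D = 0 makes -A a perfect
  square.\<close>

lemma syzygy:
  fixes p0 p1 p2 p3 :: int
  shows "p0^2 * disc (p0, p1, p2, p3) = (p0^2 * p3 - 3 * p0 * p1 * p2 + 2 * p1^3)^2 + 4 * (p0 * p2 - p1^2)^3"
  by simp algebra

text \<open>The linear forms are the cube roots of (f \<plusminus> G / D^(1/2)) / 2, where G is the cubic covariant of f.\<close>

lemma sum_of_cubes_exists:
  assumes "p = (q, p1, p2, p3)" "q \<noteq> 0" "disc p > 0"
  obtains x0 x1 y0 y1 where "sum_of_cubes p x0 x1 y0 y1" "x0 * y1 - x1 * y0 > 0"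
proof -
  define D where "D = real_of_int (disc p)"
  define w where "w = root 6 D"
  have "D > 0" using assms(3) unfolding D_def by (simp only: of_int_0_less_iff)
  then have w: "w > 0" "w ^ 6 = D" by (simp_all add: w_def)
  define A where "A = real_of_int q * p2 - (real_of_int p1)^2"
  define G where "G = (real_of_int q)^2 * p3 - 3 * q * p1 * p2 + 2 * (real_of_int p1)^3"
  have GA: "G^2 + 4 * A^3 = (real_of_int q)^2 * D"
    using arg_cong[OF syzygy[of q p1 p2 p3], of real_of_int]
    by (simp add: A_def G_def D_def assms(1) del: disc.simps)
  define u where "u = root 3 ((q + G / w^3) / 2)"
  define v where "v = root 3 ((q - G / w^3) / 2)"
  have u3: "u^3 = (q + G / w^3) / 2" and v3: "v^3 = (q - G / w^3) / 2"
    by (simp_all add: u_def v_def odd_real_root_pow)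
  have q: "u^3 + v^3 = q" and G: "w^3 * (u^3 - v^3) = G"
    using w(1) by (simp_all add: u3 v3 field_simps)
  \<comment> \<open>The product of the two cube roots is found through its cube, using 4 (u v)^3 =
    (u^3 + v^3)^2 - (u^3 - v^3)^2; real cube roots are unique.\<close>
  have "(w^2 * (u * v))^3 = A^3"
  proof -
    have "4 * (w^2 * (u * v))^3 = w^6 * ((u^3 + v^3)^2 - (u^3 - v^3)^2)" by algebra
    also have "\<dots> = w^6 * (real_of_int q)^2 - G^2" unfolding q G[symmetric] by algebra
    also have "\<dots> = 4 * A^3" unfolding w(2) using GA by (metis add_diff_cancel_left' mult.commute)
    finally show ?thesis by simp
  qed
  then have A: "w^2 * (u * v) = A"
    by (metis odd_real_root_power_cancel odd_numeral)
  \<comment> \<open>\<open>u'\<close> and \<open>v'\<close> solve the linear system u^2 u' + v^2 v'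
    = p1, u v' - v u' = w, whose determinant is u^3 + v^3 = q. The equations for p2 and p3 then have
    to be checked.\<close>
  define u' where "u' = (p1 * u - w * v^2) / q"
  define v' where "v' = (w * u^2 + p1 * v) / q"
  have q0: "real_of_int q \<noteq> 0" using assms by simp
  have u': "q * u' = p1 * u - w * v^2" and v': "q * v' = w * u^2 + p1 * v"
    using q0 by (simp_all add: u'_def v'_def)
  have "q * (u * v' - u' * v) = u * (q * v') - v * (q * u')" by (simp add: algebra_simps)
  also have "\<dots> = w * (u^3 + v^3)"
    unfolding u' v' by (simp add: algebra_simps power2_eq_square power3_eq_cube)
  finally have det: "u * v' - u' * v = w" using q0 by (simp add: q)
  have "q * (u^2 * u' + v^2 * v') = u^2 * (q * u') + v^2 * (q * v')" by (simp add: algebra_simps)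
  also have "\<dots> = p1 * (u^3 + v^3)"
    unfolding u' v' by (simp add: algebra_simps power2_eq_square power3_eq_cube)
  finally have "q * (u^2 * u' + v^2 * v') = q * p1" by (simp add: q)
  then have 1: "u^2 * u' + v^2 * v' = p1" using q0 by simp
  have "(real_of_int q)^2 * (u * u'^2 + v * v'^2) = q * (q * p2)"
  proof -
    have "(real_of_int q)^2 * (u * u'^2 + v * v'^2) = u * (q * u')^2 + v * (q * v')^2" by (simp add: algebra_simps power2_eq_square power3_eq_cube)
    also have "\<dots> = (u^3 + v^3) * ((real_of_int p1)^2 + w^2 * (u * v))" unfolding u' v' by (simp add: algebra_simps power2_eq_square power3_eq_cube)
    also have "\<dots> = q * (q * p2)" unfolding q A by (simp add: A_def)
    finally show ?thesis .
  qed
  then have 2: "u * u'^2 + v * v'^2 = p2" using q0 by (simp add: power2_eq_square)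
  have "(real_of_int q)^3 * (u'^3 + v'^3) = real_of_int q * ((real_of_int q)^2 * p3)"
  proof -
    have "(real_of_int q)^3 * (u'^3 + v'^3) = (q * u')^3 + (q * v')^3" by (simp add: algebra_simps power2_eq_square power3_eq_cube)
    also have "\<dots> = (u^3 + v^3) * ((real_of_int p1)^3 + 3 * p1 * (w^2 * (u * v)) + w^3 * (u^3 - v^3))"
      unfolding u' v' by (simp add: algebra_simps power2_eq_square power3_eq_cube)
    also have "\<dots> = real_of_int q * ((real_of_int q)^2 * p3)" unfolding q A G by (simp add: A_def G_def algebra_simps power2_eq_square power3_eq_cube)
    finally show ?thesis .
  qed
  then have 3: "u'^3 + v'^3 = p3" using q0 by (simp add: power2_eq_square power3_eq_cube)
  show thesis
    by (rule that[of u u' v v']) (use assms q 1 2 3 det w in auto)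
qed

section \<open>Reduction of cubic forms of positive discriminant\<close>

text \<open>Gauss reduction, with \<open>N\<close> the squared length: a shortest vector is
  completed to a basis whose scalar product is at most half of \<open>N a b\<close>. Lagrange's
  identity N1 N2 = dot^2 + w^2 then gives N1 N2 <= N1 N2 / 4 + w^2, hence the factor 4/3.\<close>

lemma reduced_lattice_basis:
  fixes x0 x1 y0 y1 :: real
  defines "w \<equiv> x0 * y1 - x1 * y0"
  defines "N \<equiv> \<lambda>a b. (of_int a * x0 + of_int b * x1)^2 + (of_int a * y0 + of_int b * y1)^2"
  assumes "w > 0"
  obtains a b c d :: int where "a * d - b * c = 1" "0 < N a b" "N a b \<le> N c d" "3 * (N a b * N c d) \<le> 4 * w^2"
proof -
  have coord: "of_int a * w = y1 * (of_int a * x0 + of_int b * x1) - x1 * (of_int a * y0 + of_int b * y1)"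
    "of_int b * w = x0 * (of_int a * y0 + of_int b * y1) - y0 * (of_int a * x0 + of_int b * x1)" for a b :: int
    by (simp_all add: w_def algebra_simps)
  have pos: "N a b > 0" if "(a, b) \<noteq> (0, 0)" for a b
  proof -
    have "of_int a * x0 + of_int b * x1 \<noteq> 0 \<or> of_int a * y0 + of_int b * y1 \<noteq> 0"
    proof (rule ccontr)
      assume "\<not> ?thesis"
      then have "of_int a * w = 0" "of_int b * w = 0"
        unfolding coord(1)[of a b] coord(2)[of b a] by simp_all
      then show False using that \<open>w > 0\<close> by simp
    qed
    then show ?thesis
      unfolding N_def by (simp add: sum_power2_gt_zero_iff)
  qed
  have fin: "finite {(a, b). N a b \<le> R}" for R
  proof -
    \<comment> \<open>Cramer's rule in \<open>coord\<close> recovers the integers from the two real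
      values, so short vectors have bounded coordinates.\<close>
    define M where "M = \<lceil>(\<bar>x0\<bar> + \<bar>x1\<bar> + \<bar>y0\<bar> + \<bar>y1\<bar>) * sqrt R / w\<rceil>"
    have "\<bar>a\<bar> \<le> M \<and> \<bar>b\<bar> \<le> M" if "N a b \<le> R" for a b
    proof -
      let ?X = "of_int a * x0 + of_int b * x1" and ?Y = "of_int a * y0 + of_int b * y1"
      have sq: "\<bar>?X\<bar> \<le> sqrt R" "\<bar>?Y\<bar> \<le> sqrt R"
      proof -
        have "\<bar>?X\<bar>^2 \<le> R" "\<bar>?Y\<bar>^2 \<le> R"
          using that unfolding N_def power2_abs
          by (meson order_trans le_add_same_cancel1 le_add_same_cancel2 zero_le_power2)+
        then show "\<bar>?X\<bar> \<le> sqrt R" "\<bar>?Y\<bar> \<le> sqrt R" by (simp_all only: real_le_rsqrt)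
      qed
      have bd: "\<bar>u * ?X - v * ?Y\<bar> \<le> (\<bar>u\<bar> + \<bar>v\<bar>) * sqrt R" for u v
      proof -
        have "\<bar>u * ?X - v * ?Y\<bar> \<le> \<bar>u\<bar> * \<bar>?X\<bar> + \<bar>v\<bar> * \<bar>?Y\<bar>"
          by (metis abs_mult abs_triangle_ineq4)
        also have "\<dots> \<le> \<bar>u\<bar> * sqrt R + \<bar>v\<bar> * sqrt R"
          using sq by (intro add_mono mult_left_mono) auto
        finally show ?thesis by (simp add: algebra_simps)
      qed
      have s0: "0 \<le> sqrt R" using sq(1) by linarith
      have "\<bar>of_int a * w\<bar> \<le> (\<bar>y1\<bar> + \<bar>x1\<bar>) * sqrt R"
        unfolding coord(1)[of a b] by (rule bd)
      also have "\<dots> \<le> (\<bar>x0\<bar> + \<bar>x1\<bar> + \<bar>y0\<bar> + \<bar>y1\<bar>) * sqrt R"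
        using s0 by (intro mult_right_mono) auto
      finally have a: "\<bar>real_of_int a\<bar> \<le> (\<bar>x0\<bar> + \<bar>x1\<bar> + \<bar>y0\<bar> + \<bar>y1\<bar>) * sqrt R / w"
        using \<open>w > 0\<close> by (simp add: abs_mult field_simps)
      have "\<bar>of_int b * w\<bar> \<le> (\<bar>y0\<bar> + \<bar>x0\<bar>) * sqrt R"
        unfolding coord(2)[of b a] using bd[of y0 x0] by (simp add: abs_minus_commute)
      also have "\<dots> \<le> (\<bar>x0\<bar> + \<bar>x1\<bar> + \<bar>y0\<bar> + \<bar>y1\<bar>) * sqrt R"
        using s0 by (intro mult_right_mono) auto
      finally have b: "\<bar>real_of_int b\<bar> \<le> (\<bar>x0\<bar> + \<bar>x1\<bar> + \<bar>y0\<bar> + \<bar>y1\<bar>) * sqrt R / w"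
        using \<open>w > 0\<close> by (simp add: abs_mult field_simps)
      show ?thesis using ceiling_mono[OF a] ceiling_mono[OF b] unfolding M_def of_int_abs[symmetric] ceiling_of_int by blast
    qed
    then have "{(a, b). N a b \<le> R} \<subseteq> {-M..M} \<times> {-M..M}" by (auto simp: abs_le_iff minus_le_iff)
    then show ?thesis by (rule finite_subset) simp
  qed
  obtain a b where ab: "(a, b) \<noteq> (0, 0)" and min: "\<And>c d. (c, d) \<noteq> (0, 0) \<Longrightarrow> N a b \<le> N c d"
  proof -
    define S where "S = {(a, b). N a b \<le> N 1 0} - {(0, 0)}"
    have S: "finite S" "(1, 0) \<in> S" using fin by (auto simp: S_def)
    then have "Min (case_prod N ` S) \<in> case_prod N ` S" by (intro Min_in) auto
    then obtain a b where ab: "(a, b) \<in> S" "N a b = Min (case_prod N ` S)" by auto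
    have "N a b \<le> N c d" if "(c, d) \<noteq> (0, 0)" for c d
    proof (cases "(c, d) \<in> S")
      case True
      then have "case_prod N (c, d) \<in> case_prod N ` S" by (rule imageI)
      then show ?thesis using ab S by simp
    next
      case False
      then have "N 1 0 \<le> N c d" using that by (auto simp: S_def)
      then show ?thesis using ab by (auto simp: S_def)
    qed
    then show ?thesis using that ab by (auto simp: S_def)
  qed
  have Na: "N a b > 0" using pos ab by blast
  have "coprime a b"
  proof -
    define g where "g = gcd a b"
    obtain a' b' where g: "a = g * a'" "b = g * b'" unfolding g_def by (meson dvdE gcd_dvd1 gcd_dvd2)
    have ne: "(a', b') \<noteq> (0, 0)" using ab g by auto
    have "N a b = (of_int g)^2 * N a' b'" unfolding N_def g by (simp add: algebra_simps power2_eq_square)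
    then have "(of_int g)^2 * N a' b' \<le> 1 * N a' b'" using min[OF ne] by simp
    then have "(real_of_int g)^2 \<le> 1" using pos[OF ne] by (simp only: mult_le_cancel_right_pos)
    then have "\<bar>g\<bar> \<le> 1" by (simp add: abs_square_le_1 flip: of_int_abs)
    moreover have "g > 0" using ab by (simp add: g_def)
    ultimately show ?thesis by (simp add: coprime_iff_gcd_eq_1 flip: g_def)
  qed
  then obtain u v where uv: "u * a + v * b = 1" using bezout_int[of a b] by (metis coprime_iff_gcd_eq_1)
  define dot where "dot = (\<lambda>c d. (of_int a * x0 + of_int b * x1) * (of_int c * x0 + of_int d * x1) +
    (of_int a * y0 + of_int b * y1) * (of_int c * y0 + of_int d * y1))"
  \<comment> \<open>Rounding the projection coefficient: among the shifts of the second vector by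
    multiples of the first, this one has the smallest scalar product with it.\<close>
  define k where "k = round (- dot (- v) u / N a b)"
  define c d where "c = - v + k * a" and "d = u + k * b"
  have det: "a * d - b * c = 1" using uv by (simp add: c_def d_def algebra_simps)
  have "dot c d = dot (- v) u + of_int k * N a b"
    unfolding dot_def c_def d_def N_def by (simp add: algebra_simps power2_eq_square)
  also have "\<dots> = (of_int k - (- dot (- v) u / N a b)) * N a b"
    using Na by (simp add: field_simps)
  finally have "\<bar>dot c d\<bar> = \<bar>of_int k - (- dot (- v) u / N a b)\<bar> * N a b"
    using Na by (simp add: abs_mult)
  also have "\<dots> \<le> 1/2 * N a b"
    using Na unfolding k_def by (intro mult_right_mono of_int_round_abs_le) auto
  finally have "\<bar>dot c d\<bar>^2 \<le> (1/2 * N a b)^2"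
    by (intro power_mono) auto
  then have "4 * (dot c d)^2 \<le> N a b * N a b" by (simp add: power2_eq_square field_simps)
  moreover have "N a b * N c d = (dot c d)^2 + w^2"
  proof -
    have "N a b * N c d = (dot c d)^2 + (of_int (a * d - b * c) * w)^2"
      unfolding N_def dot_def w_def by (simp add: algebra_simps power2_eq_square)
    then show ?thesis by (simp add: det)
  qed
  moreover have le: "N a b \<le> N c d" using det by (intro min) auto
  moreover have "N a b * N a b \<le> N a b * N c d" using le Na by (intro mult_left_mono) auto
  ultimately have "3 * (N a b * N c d) \<le> 4 * w^2" by linarith
  then show thesis using that det Na le by blast
qed

text \<open>Truncation at 1 keeps a vanishing coefficient from annihilating the products in which it
  occurs.\<close>

definition wt :: "int \<Rightarrow> real" where
  "wt u = max 1 \<bar>real_of_int u\<bar>"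

lemma wt_pos: "0 < wt u" and wt_nonneg: "0 \<le> wt u"
  by (auto simp: wt_def)

lemma wt_mult_wt_le:
  assumes "(real_of_int u)^2 \<le> R" "(real_of_int v)^2 \<le> R" "(real_of_int u)^2 * (real_of_int v)^2 \<le> R" "1 \<le> R"
  shows "(wt u * wt v)^2 \<le> R"
  using assms by (auto simp: wt_def max_def power_mult_distrib)

text \<open>Made for summation: D^(-1 - e) is then at most a constant times a product with one
  summable factor per coefficient. The 4 rounds up (4/3)^3.\<close>

fun long_reduced :: "cubic \<Rightarrow> bool" where
  "long_reduced (p0, p1, p2, p3) \<longleftrightarrow>
     p0 \<noteq> 0 \<and> wt p0 * wt p1 * wt p2 * wt p3 \<le> 4 * real_of_int (disc (p0, p1, p2, p3))"

text \<open>Forms with leading coefficient 0 can only be normalised by X \<rightarrow> X + k Y, so here D, which factors as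
  p1^2 (4 p1 p3 - 3 p2^2), has to be controlled through its second factor instead of p3.\<close>

fun cusp_reduced :: "cubic \<Rightarrow> bool" where
  "cusp_reduced (p0, p1, p2, p3) \<longleftrightarrow> p0 = 0 \<and> 0 \<le> p2 \<and> p2 < 2 * \<bar>p1\<bar>"

text \<open>Bounds each coefficient of a sum of two cubes by the lengths of the vectors (x0, y0) and
  (x1, y1).\<close>

lemma cauchy_schwarz_3:
  fixes a b c a' b' c' :: real
  shows "(a * b * c + a' * b' * c')^2 \<le> (a^2 + a'^2) * (b^2 + b'^2) * (c^2 + c'^2)"
proof -
  have "(a^2 + a'^2) * (b^2 + b'^2) * (c^2 + c'^2) - (a * b * c + a' * b' * c')^2
     = (a * b' * c' - a' * b * c)^2 + (a^2 + a'^2) * ((b * c')^2 + (b' * c)^2)"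
    by algebra
  moreover have "\<dots> \<ge> 0" by simp
  ultimately show ?thesis by linarith
qed

lemma cubic_reduction:
  assumes "sum_of_cubes p x0 x1 y0 y1" "x0 * y1 - x1 * y0 > 0"
  obtains a b c d where "a * d - b * c = 1"
    "long_reduced (subst_cubic p a b c d) \<or> cusp_reduced (subst_cubic p a b c d)"
proof -
  define w where "w = x0 * y1 - x1 * y0"
  define N where "N = (\<lambda>a b :: int. (of_int a * x0 + of_int b * x1)^2 + (of_int a * y0 + of_int b * y1)^2)"
  obtain a b c d :: int where det: "a * d - b * c = 1" and N: "0 < N a b" "N a b \<le> N c d"
    "3 * (N a b * N c d) \<le> 4 * w^2"
    using reduced_lattice_basis[of x0 y1 x1 y0] assms(2) unfolding N_def w_def by metis
  obtain c0 c1 c2 c3 where cs: "subst_cubic p a b c d = (c0, c1, c2, c3)" by (cases "subst_cubic p a b c d")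
  define u0 v0 u1 v1 where uv: "u0 = of_int a * x0 + of_int b * x1" "v0 = of_int a * y0 + of_int b * y1"
    "u1 = of_int c * x0 + of_int d * x1" "v1 = of_int c * y0 + of_int d * y1"
  have soc: "sum_of_cubes (c0, c1, c2, c3) u0 u1 v0 v1"
    using sum_of_cubes_subst[OF assms(1), of a b c d] by (simp only: cs uv)
  have "u0 * v1 - u1 * v0 = of_int (a * d - b * c) * w"
    by (simp add: uv w_def algebra_simps)
  then have w: "u0 * v1 - u1 * v0 = w" by (simp add: det)
  have D: "real_of_int (disc (c0, c1, c2, c3)) = w^6"
    using disc_sum_of_cubes[OF soc] by (simp only: w)
  have "w > 0" using assms(2) by (simp add: w_def)
  show thesis
  proof (cases "c0 = 0")
    case False
    define N1 N2 where "N1 = u0^2 + v0^2" and "N2 = u1^2 + v1^2"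
    have N12: "0 < N1" "N1 \<le> N2" "3 * (N1 * N2) \<le> 4 * w^2"
      using N by (simp_all add: N1_def N2_def N_def uv)
    have sq: "(real_of_int c0)^2 \<le> N1^3" "(real_of_int c1)^2 \<le> N1^2 * N2"
      "(real_of_int c2)^2 \<le> N1 * N2^2" "(real_of_int c3)^2 \<le> N2^3"
      using soc cauchy_schwarz_3[of u0 u0 u0 v0 v0 v0] cauchy_schwarz_3[of u0 u0 u1 v0 v0 v1]
        cauchy_schwarz_3[of u0 u1 u1 v0 v1 v1] cauchy_schwarz_3[of u1 u1 u1 v1 v1 v1]
      by (simp_all add: N1_def N2_def power2_eq_square power3_eq_cube mult.assoc)
    \<comment> \<open>The nonzero leading coefficient forces the shorter squared length to be at
      least 1, so that every monomial of degree at most 3 in each of \<open>N1\<close> and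
      \<open>N2\<close> is at most \<open>R\<close>.\<close>
    have "1 \<le> \<bar>real_of_int c0\<bar>" using False by linarith
    then have "1 \<le> (real_of_int c0)^2" by (metis one_le_power power2_abs)
    then have "1 \<le> N1 ^ 3" using sq by linarith
    then have N1: "1 \<le> N1" using N12(1) power_less_one_iff[of N1 3] by force
    then have N2: "1 \<le> N2" using N12 by linarith
    define R where "R = (N1 * N2)^3"
    have R: "N1^i * N2^j \<le> R" if "i \<le> 3" "j \<le> 3" for i j
      unfolding R_def power_mult_distrib using N1 N2 that by (intro mult_mono power_increasing) auto
    have R1: "1 \<le> R" using R[of 0 0] by simp
    \<comment> \<open>Outer and inner coefficients are paired because the bounds within each pair
      multiply to exactly (N1 N2)^3.\<close>
    have "(real_of_int c0)^2 * (real_of_int c3)^2 \<le> N1^3 * N2^3"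
      using sq N1 by (intro mult_mono) auto
    then have "(wt c0 * wt c3)^2 \<le> R"
      using sq R[of 3 0] R[of 0 3] R[of 3 3] R1 by (intro wt_mult_wt_le) auto
    moreover have "(real_of_int c1)^2 * (real_of_int c2)^2 \<le> (N1^2 * N2) * (N1 * N2^2)"
      using sq N1 N2 by (intro mult_mono) auto
    then have "(real_of_int c1)^2 * (real_of_int c2)^2 \<le> R"
      by (simp add: R_def power2_eq_square power3_eq_cube ac_simps)
    then have "(wt c1 * wt c2)^2 \<le> R"
      using sq R[of 2 1] R[of 1 2] R1 by (intro wt_mult_wt_le) auto
    ultimately have "(wt c0 * wt c3)^2 * (wt c1 * wt c2)^2 \<le> R * R"
      using R1 by (intro mult_mono) auto
    then have "(wt c0 * wt c1 * wt c2 * wt c3)^2 \<le> R^2"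
      by (simp add: power2_eq_square ac_simps)
    then have "wt c0 * wt c1 * wt c2 * wt c3 \<le> R"
      by (rule power2_le_imp_le) (use R1 in linarith)
    also have "R \<le> (4/3 * w^2)^3"
      unfolding R_def using N12 N1 N2 by (intro power_mono) auto
    also have "\<dots> \<le> 4 * w^6" by (simp add: power_mult_distrib power_divide flip: power_mult)
    finally have "long_reduced (c0, c1, c2, c3)"
      using False D by (simp del: disc.simps)
    then show thesis using that[of a d b c] det cs by simp
  next
    case True
    have "disc (c0, c1, c2, c3) \<noteq> 0" using D \<open>w > 0\<close> by (metis less_irrefl of_int_0 zero_less_power)
    then have c1: "c1 \<noteq> 0" using True by auto
    \<comment> \<open>As c0 = 0, the shift X -> X + k Y adds 2 k c1 to c2; this \<open>k\<close>
      leaves the residue of c2 modulo 2 |c1|.\<close>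
    define k where "k = - sgn c1 * (c2 div (2 * \<bar>c1\<bar>))"
    have "2 * k * c1 = - (2 * \<bar>c1\<bar> * (c2 div (2 * \<bar>c1\<bar>)))"
      using c1 unfolding k_def by (cases "c1 > 0") simp_all
    then have "c2 + 2 * k * c1 = c2 mod (2 * \<bar>c1\<bar>)"
      using minus_mult_div_eq_mod[of c2 "2 * \<bar>c1\<bar>"] by linarith
    then have "0 \<le> c2 + 2 * k * c1" "c2 + 2 * k * c1 < 2 * \<bar>c1\<bar>" using c1 by auto
    then have "cusp_reduced (subst_cubic (c0, c1, c2, c3) 1 0 k 1)"
      using True by (simp add: algebra_simps)
    then have "cusp_reduced (subst_cubic p a b (k * a + c) (k * b + d))"
      unfolding cs[symmetric] subst_cubic_subst_cubic by simp
    moreover have "a * (k * b + d) - b * (k * a + c) = 1" using det by (simp add: algebra_simps)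
    ultimately show thesis using that by blast
  qed
qed

section \<open>Primitive vectors with small Hessian\<close>

lemma card_spaced_le:
  fixes S :: "real set"
  assumes "d > 0" "L \<ge> 0" "\<And>x. x \<in> S \<Longrightarrow> \<bar>x\<bar> \<le> L" "\<And>x y. x \<in> S \<Longrightarrow> y \<in> S \<Longrightarrow> x \<noteq> y \<Longrightarrow> d \<le> \<bar>x - y\<bar>"
  shows "finite S \<and> real (card S) \<le> 1 + 2 * L / d"
proof -
  define g where "g = (\<lambda>x. \<lfloor>(x + L) / d\<rfloor>)"
  have inj: "inj_on g S"
  proof (rule inj_onI, rule ccontr)
    fix x y assume *: "x \<in> S" "y \<in> S" "g x = g y" "x \<noteq> y"
    then have "\<bar>(x + L) / d - (y + L) / d\<bar> < 1" unfolding g_def by linarith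
    moreover have "(x + L) / d - (y + L) / d = (x - y) / d" by (simp add: diff_divide_distrib add_divide_distrib)
    ultimately have "\<bar>x - y\<bar> < d" using \<open>d > 0\<close> by (simp add: abs_divide)
    then show False using assms(4)[of x y] * by simp
  qed
  have sub: "g ` S \<subseteq> {0..\<lfloor>2 * L / d\<rfloor>}"
  proof safe
    fix x assume "x \<in> S"
    then have "\<bar>x\<bar> \<le> L" by (rule assms(3))
    then have "0 \<le> (x + L) / d" "(x + L) / d \<le> 2 * L / d" using \<open>d > 0\<close> by (auto intro!: divide_right_mono)
    then show "g x \<in> {0..\<lfloor>2 * L / d\<rfloor>}" by (auto simp: g_def floor_mono)
  qed
  have fin: "finite S" using sub inj finite_subset finite_imageD by blast
  have "card S \<le> card {0..\<lfloor>2 * L / d\<rfloor>}"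
    using sub inj by (metis card_image card_mono finite_atLeastAtMost_int)
  also have "\<dots> = nat (\<lfloor>2 * L / d\<rfloor> + 1)" by simp
  finally have "real (card S) \<le> real (nat (\<lfloor>2 * L / d\<rfloor> + 1))" by simp
  also have "\<dots> \<le> 1 + 2 * L / d"
    using assms(1,2) by (subst of_nat_nat) (auto simp: add_increasing)
  finally show ?thesis using fin by simp
qed

lemma coprime_parallel:
  fixes m n m' n' :: int
  assumes "coprime m n" "coprime m' n'" "m * n' = m' * n"
  shows "(m', n') = (m, n) \<or> (m', n') = (- m, - n)"
proof -
  have "coprime n m" "coprime n' m'" using assms coprime_commute by blast+
  moreover have "m dvd m' * n" "m' dvd m * n'" "n dvd m * n'" "n' dvd m' * n"
    using assms(3) by (metis dvd_triv_left dvd_triv_right)+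
  ultimately have "m dvd m'" "m' dvd m" "n dvd n'" "n' dvd n"
    using assms(1,2)
    by (simp_all only: coprime_dvd_mult_left_iff coprime_dvd_mult_right_iff)
  then have "\<bar>m\<bar> = \<bar>m'\<bar>" "\<bar>n\<bar> = \<bar>n'\<bar>" by (blast intro: zdvd_antisym_abs)+
  then have "m' = m \<or> m' = - m" "n' = n \<or> n' = - n" by linarith+
  then show ?thesis using assms(3) by (elim disjE) (simp_all, blast)
qed

lemma cube_le_cube_cancel:
  fixes x y :: real
  assumes "x ^ 3 \<le> y ^ 3"
  shows "x \<le> y"
  using assms by (metis odd_numeral odd_real_root_power_cancel real_root_le_iff zero_less_numeral)

text \<open>The slopes Y / X of two distinct primitive vectors differ by at least their determinant, w, divided by
  the product of their X-coordinates.\<close>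

lemma card_primitive_sector_le:
  fixes x0 x1 y0 y1 Q H w :: real
  defines "X \<equiv> \<lambda>m n :: int. of_int m * x0 + of_int n * x1"
  defines "Y \<equiv> \<lambda>m n :: int. of_int m * y0 + of_int n * y1"
  assumes w: "\<bar>x0 * y1 - x1 * y0\<bar> = w" "w \<ge> 1" and "Q > 0" "H \<ge> 0" "4 * H^3 \<le> Q^2"
  defines "S \<equiv> {(m, n). coprime m n \<and> \<bar>Y m n\<bar> \<le> \<bar>X m n\<bar> \<and> Q \<le> X m n ^ 3 + Y m n ^ 3 \<and>
      X m n ^ 3 + Y m n ^ 3 < 2 * Q \<and> w^2 * \<bar>X m n * Y m n\<bar> \<le> H}"
  shows "finite S \<and> real (card S) \<le> 1 + 8 * H / w^3"
proof -
  \<comment> \<open>On \<open>S\<close> the bounds give |Y|^2 <= H, so 4 H^3 <= Q^2 yields |Y|^3 <=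
    Q / 2. Then X^3 lies between Q / 2 and 5 Q / 2, which places X between z and 2 z.\<close>
  define z where "z = root 3 (Q / 2)"
  have z: "z > 0" "z^3 = Q / 2" using \<open>Q > 0\<close> by (simp_all add: z_def)
  have X: "z \<le> X m n \<and> X m n \<le> 2 * z" if "(m, n) \<in> S" for m n
  proof -
    have S: "\<bar>Y m n\<bar> \<le> \<bar>X m n\<bar>" "Q \<le> X m n ^ 3 + Y m n ^ 3" "X m n ^ 3 + Y m n ^ 3 < 2 * Q"
      "w^2 * \<bar>X m n * Y m n\<bar> \<le> H" using that by (auto simp: S_def)
    have "1 * \<bar>X m n * Y m n\<bar> \<le> w^2 * \<bar>X m n * Y m n\<bar>" using w by (intro mult_right_mono) auto
    then have XY: "\<bar>X m n * Y m n\<bar> \<le> H" using S by simp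
    have "\<bar>Y m n\<bar> * \<bar>Y m n\<bar> \<le> \<bar>X m n\<bar> * \<bar>Y m n\<bar>" using S by (intro mult_right_mono) auto
    then have "\<bar>Y m n\<bar>^2 \<le> H" using XY by (simp add: abs_mult power2_eq_square)
    then have "(\<bar>Y m n\<bar>^2)^3 \<le> H^3" by (intro power_mono) auto
    then have "(\<bar>Y m n\<bar>^3)^2 \<le> (Q / 2)^2"
      using assms(7) by (simp add: power_divide flip: power_mult)
    then have "\<bar>Y m n\<bar>^3 \<le> Q / 2" by (rule power2_le_imp_le) (use \<open>Q > 0\<close> in linarith)
    then have Y: "\<bar>Y m n ^ 3\<bar> \<le> z^3" unfolding z power_abs .
    have "z^3 \<le> X m n ^ 3" "X m n ^ 3 \<le> (2 * z)^3" using Y S z by (auto simp: power_mult_distrib abs_le_iff)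
    then show ?thesis using cube_le_cube_cancel by blast
  qed
  define \<sigma> where "\<sigma> = (\<lambda>(m, n). Y m n / X m n)"
  have bound: "\<bar>\<sigma> v\<bar> \<le> H / (w^2 * z^2)" if "v \<in> S" for v
  proof -
    obtain m n where v: "v = (m, n)" by (cases v)
    have x: "z \<le> X m n" using X that v by blast
    \<comment> \<open>The Hessian bound controls the slope through |Y / X| = |X Y| / X^2.\<close>
    have "\<bar>\<sigma> v\<bar> = (w^2 * \<bar>X m n * Y m n\<bar>) / (w^2 * (X m n)^2)"
      using x z w by (simp add: v \<sigma>_def abs_mult power2_eq_square)
    also have "\<dots> \<le> H / (w^2 * z^2)"
      using that v x z w \<open>H \<ge> 0\<close> by (intro frac_le mult_left_mono power_mono mult_pos_pos) (auto simp: S_def)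
    finally show ?thesis .
  qed
  have sep: "w / (4 * z^2) \<le> \<bar>\<sigma> v - \<sigma> v'\<bar>" if vS: "v \<in> S" "v' \<in> S" "v \<noteq> v'" for v v'
  proof -
    obtain m n m' n' where v: "v = (m, n)" "v' = (m', n')" by (cases v, cases v')
    have x: "z \<le> X m n" "X m n \<le> 2 * z" "z \<le> X m' n'" "X m' n' \<le> 2 * z" using X that v by blast+
    have "m * n' \<noteq> m' * n"
    proof
      assume "m * n' = m' * n"
      \<comment> \<open>Opposite vectors cannot both occur, since X is positive on
        \<open>S\<close>.\<close>
      then have "(m', n') = (- m, - n)"
        using coprime_parallel[of m n m' n'] vS by (auto simp: v S_def)
      then have "X m' n' = - X m n" by (simp add: X_def)
      then show False using x z by simp
    qed
    then have "1 \<le> \<bar>real_of_int (m * n' - m' * n)\<bar>" by linarith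
    then have "w * 1 \<le> w * \<bar>real_of_int (m * n' - m' * n)\<bar>" using w by (intro mult_left_mono) auto
    also have "\<dots> = \<bar>Y m n * X m' n' - Y m' n' * X m n\<bar>"
    proof -
      have "Y m n * X m' n' - Y m' n' * X m n = (x1 * y0 - x0 * y1) * real_of_int (m * n' - m' * n)"
        by (simp add: X_def Y_def algebra_simps)
      then show ?thesis using w by (simp add: abs_mult abs_minus_commute)
    qed
    finally have 1: "w \<le> \<bar>Y m n * X m' n' - Y m' n' * X m n\<bar>" by simp
    have "\<sigma> v - \<sigma> v' = (Y m n * X m' n' - Y m' n' * X m n) / (X m n * X m' n')"
      using x z by (simp add: v \<sigma>_def field_simps)
    then have "\<bar>\<sigma> v - \<sigma> v'\<bar> = \<bar>Y m n * X m' n' - Y m' n' * X m n\<bar> / (X m n * X m' n')"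
      using x z by (simp add: abs_divide abs_mult)
    moreover have "X m n * X m' n' \<le> (2 * z) * (2 * z)" using x z by (intro mult_mono) auto
    ultimately show ?thesis
      using 1 x z w by (auto intro!: frac_le mult_pos_pos simp: power2_eq_square)
  qed
  have d: "w / (4 * z^2) > 0" using w z by simp
  have inj: "inj_on \<sigma> S"
    by (rule inj_onI) (use sep d in force)
  have "finite (\<sigma> ` S) \<and> real (card (\<sigma> ` S)) \<le> 1 + 2 * (H / (w^2 * z^2)) / (w / (4 * z^2))"
  proof (rule card_spaced_le)
    show "0 \<le> H / (w^2 * z^2)" using \<open>H \<ge> 0\<close> by simp
    show "w / (4 * z^2) > 0" by (rule d)
    show "\<bar>x\<bar> \<le> H / (w^2 * z^2)" if "x \<in> \<sigma> ` S" for x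
      using that bound by blast
    show "w / (4 * z^2) \<le> \<bar>x - y\<bar>" if "x \<in> \<sigma> ` S" "y \<in> \<sigma> ` S" "x \<noteq> y" for x y
      using that sep by blast
  qed
  moreover have "2 * (H / (w^2 * z^2)) / (w / (4 * z^2)) = 8 * H / w^3"
    using w z by (simp add: field_simps power2_eq_square power3_eq_cube)
  ultimately show ?thesis using inj by (simp add: card_image finite_image_iff)
qed

text \<open>The second row (r, s) is not recorded: the conditions concern the values of the form and
  of its Hessian at (m, n), which are the same for every completion.\<close>

definition primitive_reps :: "cubic \<Rightarrow> real \<Rightarrow> real \<Rightarrow> (int \<times> int) set" where
  "primitive_reps c Q H = {(m, n). \<exists>r s p0 p1 p2 p3. m * s - n * r = 1 \<and> subst_cubic c m n r s = (p0, p1, p2, p3) \<and>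
     Q \<le> real_of_int p0 \<and> real_of_int p0 < 2 * Q \<and> \<bar>real_of_int (hess (p0, p1, p2, p3))\<bar> \<le> H}"

text \<open>Either linear form may be the larger one at (m, n), so the sector estimate is applied
  twice, with the roles of the forms exchanged.\<close>

lemma card_primitive_reps_le:
  assumes c: "sum_of_cubes c x0 x1 y0 y1" and w: "x0 * y1 - x1 * y0 = w" "w > 0"
    and "Q > 0" "H \<ge> 0" "4 * H^3 \<le> Q^2"
  shows "finite (primitive_reps c Q H) \<and> real (card (primitive_reps c Q H)) \<le> 2 + 16 * H / w^3"
proof -
  define X where "X = (\<lambda>m n :: int. of_int m * x0 + of_int n * x1)"
  define Y where "Y = (\<lambda>m n :: int. of_int m * y0 + of_int n * y1)"
  define S where "S = (\<lambda>(X :: int \<Rightarrow> int \<Rightarrow> real) Y. {(m, n). coprime m n \<and> \<bar>Y m n\<bar> \<le> \<bar>X m n\<bar> \<and> Q \<le> X m n ^ 3 + Y m n ^ 3 \<and>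
      X m n ^ 3 + Y m n ^ 3 < 2 * Q \<and> w^2 * \<bar>X m n * Y m n :: real\<bar> \<le> H})"
  \<comment> \<open>w^6 is the discriminant, a positive integer.\<close>
  have "1 \<le> w ^ 6"
  proof -
    have D: "real_of_int (disc c) = w ^ 6" using disc_sum_of_cubes[OF c] w by simp
    then have "disc c > 0" using w by (metis of_int_0_less_iff zero_less_power)
    then show ?thesis unfolding D[symmetric] by linarith
  qed
  then have w1: "w \<ge> 1" using w power_less_one_iff[of w 6] by force
  have S1: "finite (S X Y) \<and> real (card (S X Y)) \<le> 1 + 8 * H / w^3"
    unfolding S_def X_def Y_def
    by (rule card_primitive_sector_le) (use w w1 assms in auto)
  have S2: "finite (S Y X) \<and> real (card (S Y X)) \<le> 1 + 8 * H / w^3"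
    unfolding S_def X_def Y_def
    by (rule card_primitive_sector_le) (use w w1 assms in \<open>auto simp: abs_minus_commute mult.commute\<close>)
  have sub: "primitive_reps c Q H \<subseteq> S X Y \<union> S Y X"
  proof
    fix v assume "v \<in> primitive_reps c Q H"
    then obtain m n r s p0 p1 p2 p3 where v: "v = (m, n)" and det: "m * s - n * r = 1"
      and p: "subst_cubic c m n r s = (p0, p1, p2, p3)" "Q \<le> real_of_int p0" "real_of_int p0 < 2 * Q"
        "\<bar>real_of_int (hess (p0, p1, p2, p3))\<bar> \<le> H"
      unfolding primitive_reps_def by blast
    have soc: "sum_of_cubes (p0, p1, p2, p3) (X m n) (X r s) (Y m n) (Y r s)"
      using sum_of_cubes_subst[OF c, of m n r s] by (simp only: p X_def Y_def)
    have "X m n * Y r s - X r s * Y m n = of_int (m * s - n * r) * w"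
      unfolding X_def Y_def w(1)[symmetric] by (simp add: algebra_simps)
    then have "real_of_int (hess (p0, p1, p2, p3)) = w^2 * (X m n * Y m n)"
      using hess_sum_of_cubes[OF soc] det by (simp only:) simp
    then have "w^2 * \<bar>X m n * Y m n\<bar> \<le> H" using p by (simp add: abs_mult)
    moreover have "coprime m n"
    proof (rule coprimeI)
      fix k assume "k dvd m" "k dvd n"
      then have "k dvd m * s - n * r" by simp
      then show "is_unit k" using det by simp
    qed
    ultimately show "v \<in> S X Y \<union> S Y X"
      using p soc by (auto simp: v S_def ac_simps)
  qed
  have "card (primitive_reps c Q H) \<le> card (S X Y) + card (S Y X)"
    using sub S1 S2 by (meson card_Un_le card_mono finite_Un order_trans)
  then show ?thesis using sub S1 S2 finite_subset[OF sub] by auto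
qed

section \<open>Summation over reduced forms\<close>

lemma sum_wt_powr_bounded:
  assumes "e > 0"
  obtains B where "0 \<le> B" "\<And>F. finite F \<Longrightarrow> (\<Sum>u\<in>F. wt u powr - (1 + e)) \<le> B"
proof -
  define g where "g = (\<lambda>n::nat. max 1 (real n) powr - (1 + e))"
  have "summable g"
  proof (rule summable_cong[THEN iffD1])
    show "summable (\<lambda>n. real n powr - (1 + e))" using assms by (simp add: summable_real_powr_iff)
    show "\<forall>\<^sub>F n in sequentially. real n powr - (1 + e) = g n"
      using eventually_ge_at_top[of 1] by eventually_elim (simp add: g_def)
  qed
  have part: "(\<Sum>u\<in>F. wt u powr - (1 + e)) \<le> suminf g" if "finite F" "inj_on (\<lambda>u. nat \<bar>u\<bar>) F" for F
  proof -
    have "(\<Sum>u\<in>F. wt u powr - (1 + e)) = (\<Sum>n\<in>(\<lambda>u. nat \<bar>u\<bar>) ` F. g n)"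
      using that by (simp add: sum.reindex g_def wt_def)
    also have "\<dots> \<le> suminf g"
      using that \<open>summable g\<close> by (intro sum_le_suminf) (auto simp: g_def)
    finally show ?thesis .
  qed
  have "(\<Sum>u\<in>F. wt u powr - (1 + e)) \<le> 2 * suminf g" if "finite F" for F
  proof -
    have "F = F \<inter> {0..} \<union> F \<inter> {..<0}" by auto
    then have "(\<Sum>u\<in>F. wt u powr - (1 + e)) =
        (\<Sum>u\<in>F \<inter> {0..}. wt u powr - (1 + e)) + (\<Sum>u\<in>F \<inter> {..<0}. wt u powr - (1 + e))"
      using that by (subst sum.union_disjoint[symmetric]) auto
    also have "\<dots> \<le> suminf g + suminf g"
      using that by (intro add_mono part) (auto simp: inj_on_def)
    finally show ?thesis by simp
  qed
  moreover have "0 \<le> 2 * suminf g"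
    using \<open>summable g\<close> by (simp add: suminf_nonneg g_def)
  ultimately show thesis using that by blast
qed

text \<open>A finite set of pairs lies in the product of its projections, over which the sum
  factors.\<close>

lemma sum_prod_bounded:
  fixes f :: "'a \<Rightarrow> real" and g :: "'b \<Rightarrow> real"
  assumes "\<And>a. 0 \<le> f a" "\<And>b. 0 \<le> g b" "0 \<le> B1"
    and "\<And>F. finite F \<Longrightarrow> sum f F \<le> B1" "\<And>F. finite F \<Longrightarrow> sum g F \<le> B2" and "finite C"
  shows "(\<Sum>(a, b)\<in>C. f a * g b) \<le> B1 * B2"
proof -
  have "(\<Sum>(a, b)\<in>C. f a * g b) \<le> (\<Sum>(a, b)\<in>fst ` C \<times> snd ` C. f a * g b)"
    using assms by (intro sum_mono2) (auto simp: subset_fst_snd case_prod_unfold)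
  also have "\<dots> = sum f (fst ` C) * sum g (snd ` C)"
    by (simp add: sum_product sum.cartesian_product)
  also have "\<dots> \<le> B1 * B2"
    using assms by (intro mult_mono sum_nonneg) auto
  finally show ?thesis .
qed

lemma disc_cusp: "disc (0, p1, p2, p3) = p1^2 * (4 * p1 * p3 - 3 * p2^2)"
  by (simp add: algebra_simps power2_eq_square)

text \<open>Both kinds of reduced forms have D bounded below, up to a constant, by a product of
  weights of integers that determine the form, so the sum is dominated by a product of convergent
  sums.\<close>

lemma sum_disc_powr_bounded:
  assumes "e > 0"
  obtains B where "0 \<le> B" "\<And>C. finite C \<Longrightarrow> (\<And>c. c \<in> C \<Longrightarrow> 0 < disc c \<and> (long_reduced c \<or> cusp_reduced c)) \<Longrightarrow>
     (\<Sum>c\<in>C. real_of_int (disc c) powr - (1 + e)) \<le> B"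
proof -
  define f where "f = (\<lambda>u. wt u powr - (1 + e))"
  obtain B where B: "0 \<le> B" "\<And>F. finite F \<Longrightarrow> sum f F \<le> B"
    using sum_wt_powr_bounded[OF assms] unfolding f_def by blast
  have f0: "0 \<le> f u" for u by (simp add: f_def)
  have sum2: "(\<Sum>(a, b)\<in>F. f a * f b) \<le> B * B" if "finite F" for F
    using that B f0 by (intro sum_prod_bounded) auto
  have sum3: "(\<Sum>(a, b, c)\<in>F. f a * (f b * f c)) \<le> B * (B * B)" if "finite F" for F
    using sum_prod_bounded[of f "\<lambda>(b, c). f b * f c" B "B * B" F] that B f0 sum2
    by (simp add: case_prod_unfold)
  have sum4: "(\<Sum>(a, b, c, d)\<in>F. f a * (f b * (f c * f d))) \<le> B * (B * (B * B))" if "finite F" for F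
    using sum_prod_bounded[of f "\<lambda>(b, c, d). f b * (f c * f d)" B "B * (B * B)" F] that B f0 sum3
    by (simp add: case_prod_unfold)
  have powr_le: "D powr - (1 + e) \<le> k powr (1 + e) * (P powr - (1 + e))" if "P \<le> k * D" "0 < P" "0 < k" for D P k
  proof -
    have "D powr - (1 + e) \<le> (P / k) powr - (1 + e)"
      using that assms by (intro powr_mono2') (auto simp: field_simps)
    also have "\<dots> = P powr - (1 + e) / k powr - (1 + e)"
      using that by (simp add: powr_divide)
    also have "\<dots> = k powr (1 + e) * (P powr - (1 + e))"
      by (simp only: powr_minus[of k] divide_inverse inverse_inverse_eq mult.commute)
    finally show ?thesis .
  qed
  have long: "(\<Sum>c\<in>C. real_of_int (disc c) powr - (1 + e)) \<le> 4 powr (1 + e) * (B * (B * (B * B)))"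
    if C: "finite C" "\<And>c. c \<in> C \<Longrightarrow> long_reduced c" for C
  proof -
    have "(\<Sum>c\<in>C. real_of_int (disc c) powr - (1 + e)) \<le>
        (\<Sum>c\<in>C. 4 powr (1 + e) * (case c of (c0, c1, c2, c3) \<Rightarrow> f c0 * (f c1 * (f c2 * f c3))))"
    proof (rule sum_mono)
      fix c assume "c \<in> C"
      obtain c0 c1 c2 c3 where c: "c = (c0, c1, c2, c3)" by (cases c)
      have "wt c0 * wt c1 * wt c2 * wt c3 \<le> 4 * real_of_int (disc c)"
        using C(2)[OF \<open>c \<in> C\<close>] by (simp add: c del: disc.simps)
      then have "real_of_int (disc c) powr - (1 + e) \<le>
          4 powr (1 + e) * ((wt c0 * wt c1 * wt c2 * wt c3) powr - (1 + e))"
        by (rule powr_le) (simp_all add: wt_pos)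
      also have "\<dots> = 4 powr (1 + e) * (case c of (c0, c1, c2, c3) \<Rightarrow> f c0 * (f c1 * (f c2 * f c3)))"
        by (simp add: c f_def powr_mult wt_nonneg)
      finally show "real_of_int (disc c) powr - (1 + e) \<le>
          4 powr (1 + e) * (case c of (c0, c1, c2, c3) \<Rightarrow> f c0 * (f c1 * (f c2 * f c3)))" .
    qed
    also have "\<dots> \<le> 4 powr (1 + e) * (B * (B * (B * B)))"
      unfolding sum_distrib_left[symmetric] using sum4[OF C(1)] by (intro mult_left_mono) auto
    finally show ?thesis .
  qed
  have cusp: "(\<Sum>c\<in>C. real_of_int (disc c) powr - (1 + e)) \<le> 2 powr (1 + e) * (B * (B * B))"
    if C: "finite C" "\<And>c. c \<in> C \<Longrightarrow> 0 < disc c \<and> cusp_reduced c" for C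
  proof -
    \<comment> \<open>The second factor j of D = c1^2 j replaces c3 as a summation variable; c3 is
      recovered from it because c1 is nonzero.\<close>
    define \<phi> :: "cubic \<Rightarrow> int \<times> int \<times> int" where
      "\<phi> = (\<lambda>(c0, c1, c2, c3). (c1, c2, 4 * c1 * c3 - 3 * c2^2))"
    have shape: "\<exists>c1 c2 c3. c = (0, c1, c2, c3) \<and> c1 \<noteq> 0 \<and> 0 \<le> c2 \<and> c2 < 2 * \<bar>c1\<bar> \<and> 0 < 4 * c1 * c3 - 3 * c2^2"
      if cC: "c \<in> C" for c
    proof -
      obtain c1 c2 c3 where c: "c = (0, c1, c2, c3)" "0 \<le> c2" "c2 < 2 * \<bar>c1\<bar>"
        using C(2)[OF cC] by (cases c) auto
      have "0 < c1^2 * (4 * c1 * c3 - 3 * c2^2)"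
        using C(2)[OF cC] unfolding c disc_cusp by blast
      then have "0 < 4 * c1 * c3 - 3 * c2^2" by (simp add: zero_less_mult_iff)
      then show ?thesis using c by auto
    qed
    have inj: "inj_on \<phi> C"
    proof (rule inj_onI)
      fix c c' assume c: "c \<in> C" "c' \<in> C" "\<phi> c = \<phi> c'"
      then show "c = c'" using shape[OF c(1)] shape[OF c(2)] by (auto simp: \<phi>_def)
    qed
    have "(\<Sum>c\<in>C. real_of_int (disc c) powr - (1 + e)) \<le>
        (\<Sum>c\<in>C. 2 powr (1 + e) * (case \<phi> c of (u, v, j) \<Rightarrow> f u * (f v * f j)))"
    proof (rule sum_mono)
      fix c assume "c \<in> C"
      from shape[OF this] obtain c1 c2 c3 where c: "c = (0, c1, c2, c3)" "c1 \<noteq> 0" "0 \<le> c2" "c2 < 2 * \<bar>c1\<bar>"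
        "0 < 4 * c1 * c3 - 3 * c2^2" by blast
      define j where "j = 4 * c1 * c3 - 3 * c2^2"
      \<comment> \<open>One of the two factors |c1| in D pays for the sum over c2, since c2 < 2
        |c1|.\<close>
      have "wt c1 = \<bar>real_of_int c1\<bar>" "wt c2 \<le> 2 * \<bar>real_of_int c1\<bar>" "wt j = real_of_int j"
        using c unfolding wt_def j_def[symmetric] by linarith+
      then have "wt c1 * (wt c2 * wt j) \<le> \<bar>real_of_int c1\<bar> * ((2 * \<bar>real_of_int c1\<bar>) * real_of_int j)"
        using wt_nonneg by (intro mult_mono mult_nonneg_nonneg) (auto simp: wt_def)
      also have "\<dots> = 2 * (\<bar>real_of_int c1\<bar>^2 * real_of_int j)"
        by (simp add: power2_eq_square)
      also have "\<dots> = 2 * real_of_int (disc c)"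
        unfolding c(1) disc_cusp j_def[symmetric] by simp
      finally have "real_of_int (disc c) powr - (1 + e) \<le>
          2 powr (1 + e) * ((wt c1 * (wt c2 * wt j)) powr - (1 + e))"
        by (rule powr_le) (simp_all add: wt_pos)
      also have "\<dots> = 2 powr (1 + e) * (case \<phi> c of (u, v, j) \<Rightarrow> f u * (f v * f j))"
        by (simp add: c(1) \<phi>_def j_def f_def powr_mult wt_nonneg)
      finally show "real_of_int (disc c) powr - (1 + e) \<le>
          2 powr (1 + e) * (case \<phi> c of (u, v, j) \<Rightarrow> f u * (f v * f j))" .
    qed
    also have "\<dots> = 2 powr (1 + e) * (\<Sum>(u, v, j)\<in>\<phi> ` C. f u * (f v * f j))"
      unfolding sum_distrib_left[symmetric] by (simp add: sum.reindex[OF inj])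
    also have "\<dots> \<le> 2 powr (1 + e) * (B * (B * B))"
      using sum3[of "\<phi> ` C"] C(1) by (intro mult_left_mono) auto
    finally show ?thesis .
  qed
  show thesis
  proof (rule that)
    show "0 \<le> 4 powr (1 + e) * (B * (B * (B * B))) + 2 powr (1 + e) * (B * (B * B))" using B by simp
    fix C assume C: "finite C" "\<And>c. c \<in> C \<Longrightarrow> 0 < disc c \<and> (long_reduced c \<or> cusp_reduced c)"
    have "(\<Sum>c\<in>C. real_of_int (disc c) powr - (1 + e)) =
        (\<Sum>c\<in>C \<inter> Collect long_reduced. real_of_int (disc c) powr - (1 + e)) +
        (\<Sum>c\<in>C - Collect long_reduced. real_of_int (disc c) powr - (1 + e))"
      by (rule sum.Int_Diff[OF C(1)])
    also have "\<dots> \<le> 4 powr (1 + e) * (B * (B * (B * B))) + 2 powr (1 + e) * (B * (B * B))"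
      using C by (intro add_mono long cusp) auto
    finally show "(\<Sum>c\<in>C. real_of_int (disc c) powr - (1 + e)) \<le>
      4 powr (1 + e) * (B * (B * (B * B))) + 2 powr (1 + e) * (B * (B * B))" .
  qed
qed

section \<open>Points near the curve with nonzero discriminant\<close>

text \<open>The inverse of the reducing substitution leads from the reduced form back to
  \<open>p\<close>; its first row is the primitive vector to be counted.\<close>

lemma reduced_code_exists:
  assumes "p = (p0, p1, p2, p3)" "p0 \<noteq> 0" "0 < disc p"
  shows "\<exists>c m n r s x0 x1 y0 y1. m * s - n * r = 1 \<and> subst_cubic c m n r s = p \<and>
    (long_reduced c \<or> cusp_reduced c) \<and> disc c = disc p \<and> sum_of_cubes c x0 x1 y0 y1 \<and> 0 < x0 * y1 - x1 * y0"
proof -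
  obtain x0 x1 y0 y1 where p: "sum_of_cubes p x0 x1 y0 y1" "x0 * y1 - x1 * y0 > 0"
    using sum_of_cubes_exists[OF assms] by blast
  obtain a b c d where red: "a * d - b * c = 1"
    "long_reduced (subst_cubic p a b c d) \<or> cusp_reduced (subst_cubic p a b c d)"
    using cubic_reduction[OF p] by blast
  let ?X0 = "of_int a * x0 + of_int b * x1" and ?X1 = "of_int c * x0 + of_int d * x1"
  let ?Y0 = "of_int a * y0 + of_int b * y1" and ?Y1 = "of_int c * y0 + of_int d * y1"
  have soc: "sum_of_cubes (subst_cubic p a b c d) ?X0 ?X1 ?Y0 ?Y1"
    by (rule sum_of_cubes_subst[OF p(1)])
  have "?X0 * ?Y1 - ?X1 * ?Y0 = of_int (a * d - b * c) * (x0 * y1 - x1 * y0)"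
    by (simp add: algebra_simps)
  then have det: "?X0 * ?Y1 - ?X1 * ?Y0 = x0 * y1 - x1 * y0" by (simp add: red(1))
  have "real_of_int (disc (subst_cubic p a b c d)) = real_of_int (disc p)"
    unfolding disc_sum_of_cubes[OF soc] disc_sum_of_cubes[OF p(1)] det ..
  then have "disc (subst_cubic p a b c d) = disc p" by (simp only: of_int_eq_iff)
  moreover have "d * a - (- b) * (- c) = 1" using red(1) by (simp add: algebra_simps)
  ultimately show ?thesis
    using subst_cubic_inverse[OF red(1), of p] red(2) soc det p(2) by metis
qed

text \<open>Two completions of (m, n) to a unimodular matrix differ by an integer k, which shifts p1 / p0 by k.\<close>

lemma subst_cubic_eqI:
  assumes "m * s - n * r = 1" "m * s' - n * r' = 1"
    and "subst_cubic c m n r s = (p0, p1, p2, p3)" "subst_cubic c m n r' s' = (q0, q1, q2, q3)"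
    and "p0 \<noteq> 0" "p1 div p0 = q1 div q0"
  shows "(p0, p1, p2, p3) = (q0, q1, q2, q3)"
proof -
  obtain c0 c1 c2 c3 where c: "c = (c0, c1, c2, c3)" by (cases c)
  \<comment> \<open>The coefficient of (m, n) when (r', s') is expanded in the basis (m, n), (r, s);
    the coefficient of (r, s) is 1.\<close>
  define k where "k = s * r' - r * s'"
  have r': "r' = r + k * m" and s': "s' = s + k * n"
    using assms(1,2) unfolding k_def by algebra+
  have q0: "q0 = p0" using assms(3,4) by (auto simp: c)
  have "q1 = p1 + k * p0"
    using assms(3,4) by (auto simp: c r' s' algebra_simps power2_eq_square power3_eq_cube)
  then have "q1 div q0 = p1 div p0 + k" using \<open>p0 \<noteq> 0\<close> by (simp add: q0)
  then have "k = 0" using assms(6) by simp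
  then show ?thesis using assms(3,4) r' s' by simp
qed

text \<open>The bound on p1 selects finitely many translates: shifts X -> X + k Y preserve the
  leading coefficient, \<open>hess\<close> and \<open>disc\<close>.\<close>

definition near_points :: "int \<Rightarrow> real \<Rightarrow> real \<Rightarrow> cubic set" where
  "near_points K Q H = {(p0, p1, p2, p3). Q \<le> real_of_int p0 \<and> real_of_int p0 < 2 * Q \<and> \<bar>p1\<bar> \<le> K * p0 \<and>
     \<bar>real_of_int (hess (p0, p1, p2, p3))\<bar> \<le> H \<and> 0 < disc (p0, p1, p2, p3) \<and>
     real_of_int (disc (p0, p1, p2, p3)) \<le> 5 * H^2}"

text \<open>Points are coded by a reduced form, a primitive vector and an integer translation. The
  vectors are counted for each reduced form, and the resulting weights D^(-1 - e) are then
  summed.\<close>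

lemma card_near_points_le:
  assumes "e > 0" "K \<ge> 0"
  obtains B where "\<And>Q H. Q > 0 \<Longrightarrow> H \<ge> 1 \<Longrightarrow> 4 * H^3 \<le> Q^2 \<Longrightarrow>
    finite (near_points K Q H) \<and> real (card (near_points K Q H)) \<le> B * H powr (2 + 2 * e)"
proof -
  obtain B where B: "0 \<le> B" "\<And>C. finite C \<Longrightarrow> (\<And>c. c \<in> C \<Longrightarrow> 0 < disc c \<and> (long_reduced c \<or> cusp_reduced c)) \<Longrightarrow>
     (\<Sum>c\<in>C. real_of_int (disc c) powr - (1 + e)) \<le> B"
    using sum_disc_powr_bounded[OF assms(1)] by metis
  define B' where "B' = (21 * 5 powr (1/2 + e) * B) * (2 * real_of_int K + 1)"
  \<comment> \<open>Stated for finite subsets with a uniform bound, from which the finiteness of the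
    whole set follows at the end.\<close>
  have card_le: "real (card F) \<le> B' * H powr (2 + 2 * e)"
    if QH: "Q > 0" "H \<ge> 1" "4 * H^3 \<le> Q^2" and F: "finite F" "F \<subseteq> near_points K Q H" for Q H F
  proof -
    let ?P = "\<lambda>p c m n r s x0 x1 y0 y1. m * s - n * r = 1 \<and> subst_cubic c m n r s = p \<and>
      (long_reduced c \<or> cusp_reduced c) \<and> disc c = disc p \<and> sum_of_cubes c x0 x1 y0 y1 \<and> 0 < x0 * y1 - x1 * y0"
    have "\<exists>c m n r s x0 x1 y0 y1. ?P p c m n r s x0 x1 y0 y1" if "p \<in> F" for p
    proof -
      obtain p0 p1 p2 p3 where p: "p = (p0, p1, p2, p3)" by (cases p)
      have "p0 \<noteq> 0" "0 < disc p" using that F(2) \<open>Q > 0\<close> by (auto simp: near_points_def p)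
      then show ?thesis using reduced_code_exists[OF p] by blast
    qed
    then obtain c m n r s x0 x1 y0 y1 where code: "\<And>p. p \<in> F \<Longrightarrow>
        ?P p (c p) (m p) (n p) (r p) (s p) (x0 p) (x1 p) (y0 p) (y1 p)"
      by metis
    \<comment> \<open>The integer part of p1 / p0 stands in for the completion (r, s), by
      \<open>subst_cubic_eqI\<close>; it takes at most 2 K + 1 values.\<close>
    define \<kappa> where "\<kappa> = (\<lambda>p :: cubic. ((c p, m p, n p), fst (snd p) div fst p))"
    have "inj_on \<kappa> F"
    proof (rule inj_onI)
      fix p q assume pq: "p \<in> F" "q \<in> F" "\<kappa> p = \<kappa> q"
      obtain p0 p1 p2 p3 q0 q1 q2 q3 where p: "p = (p0, p1, p2, p3)" and q: "q = (q0, q1, q2, q3)"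
        by (cases p, cases q)
      have "p0 \<noteq> 0" using pq F(2) \<open>Q > 0\<close> by (auto simp: near_points_def p)
      moreover have "c q = c p" "m q = m p" "n q = n p" "p1 div p0 = q1 div q0"
        using pq(3) by (auto simp: \<kappa>_def p q)
      ultimately show "p = q"
        using code[OF pq(1)] code[OF pq(2)] subst_cubic_eqI[of "m p" "s p" "n p" "r p" "s q" "r q" "c p" p0 p1 p2 p3 q0 q1 q2 q3]
        by (metis p q)
    qed
    define C where "C = c ` F"
    have C: "finite C" using F by (simp add: C_def)
    have C_props: "(0 < disc d \<and> (long_reduced d \<or> cusp_reduced d)) \<and> real_of_int (disc d) \<le> 5 * H^2 \<and>
        finite (primitive_reps d Q H) \<and> real (card (primitive_reps d Q H)) \<le> 21 * 5 powr (1/2 + e) * H powr (2 + 2 * e) * real_of_int (disc d) powr - (1 + e)"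
      if d: "d \<in> C" for d
    proof -
      obtain p where p: "p \<in> F" "d = c p" using d by (auto simp: C_def)
      have red: "0 < disc d" "long_reduced d \<or> cusp_reduced d" "real_of_int (disc d) \<le> 5 * H^2"
        using code[OF p(1)] p F(2) unfolding near_points_def by auto
      define w where "w = x0 p * y1 p - x1 p * y0 p"
      have w: "sum_of_cubes d (x0 p) (x1 p) (y0 p) (y1 p)" "0 < w"
        using code[OF p(1)] by (simp_all add: p w_def)
      define D where "D = real_of_int (disc d)"
      have D: "D = w^6" using disc_sum_of_cubes[OF w(1)] by (simp add: D_def w_def)
      have "D > 0" "D \<le> 5 * H^2" using red by (simp_all add: D_def)
      have card: "finite (primitive_reps d Q H) \<and> real (card (primitive_reps d Q H)) \<le> 2 + 16 * H / w^3"
        using card_primitive_reps_le[OF w(1) _ w(2)] QH by (simp add: w_def)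
      have w3: "w^3 = D powr (1/2)"
      proof -
        have "sqrt D = w^3" by (rule real_sqrt_unique) (use w(2) in \<open>simp_all add: D flip: power_mult\<close>)
        then show ?thesis using \<open>D > 0\<close> by (simp add: powr_half_sqrt)
      qed
      \<comment> \<open>w^3 = D^(1/2) is O(H), so the additive 2 is absorbed into the main term: 2
        <= 5 H / w^3 and 5 + 16 = 21.\<close>
      have "(w^3)^2 \<le> (5/2 * H)^2"
      proof -
        have "4 * w^6 \<le> 25 * H^2" using \<open>D \<le> 5 * H^2\<close> zero_le_power2[of H] unfolding D by linarith
        then show ?thesis by (simp add: power_mult_distrib power_divide flip: power_mult)
      qed
      then have "w^3 \<le> 5/2 * H" by (rule power2_le_imp_le) (use QH in simp)
      then have "2 \<le> 5 * H / w^3" using w(2) by (simp add: field_simps)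
      then have "2 + 16 * H / w^3 \<le> 21 * H / w^3"
        using add_divide_distrib[of "5 * H" "16 * H" "w^3"] by simp
      \<comment> \<open>D^(-1/2) is traded for the summable D^(-1 - e); the excess D^(1/2 + e) is
        paid for by D <= 5 H^2.\<close>
      also have "\<dots> = 21 * H * (D powr (1/2 + e) * D powr - (1 + e))"
      proof -
        have "D powr (1/2 + e) * D powr - (1 + e) = D powr (- (1/2))"
          by (simp add: powr_add[symmetric])
        also have "\<dots> = 1 / D powr (1/2)" by (rule powr_minus_divide)
        finally show ?thesis unfolding w3 by (simp only: times_divide_eq_right mult_1_right)
      qed
      also have "\<dots> \<le> 21 * H * ((5 * H^2) powr (1/2 + e) * D powr - (1 + e))"
        by (intro mult_left_mono mult_right_mono powr_mono2)
          (use QH(2) assms(1) \<open>D > 0\<close> \<open>D \<le> 5 * H^2\<close> in simp_all)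
      also have "\<dots> = 21 * 5 powr (1/2 + e) * (H * (H^2) powr (1/2 + e)) * D powr - (1 + e)"
        by (simp only: powr_mult mult_ac)
      also have "H * (H^2) powr (1/2 + e) = H powr (2 + 2 * e)"
      proof -
        have "(H^2) powr (1/2 + e) = H powr (1 + 2 * e)"
          using QH by (simp add: powr_powr algebra_simps flip: powr_numeral)
        moreover have "H * H powr (1 + 2 * e) = H powr (2 + 2 * e)"
          using QH powr_add[of H 1 "1 + 2 * e"] by simp
        ultimately show ?thesis by simp
      qed
      finally have "2 + 16 * H / w^3 \<le> 21 * 5 powr (1/2 + e) * H powr (2 + 2 * e) * D powr - (1 + e)" .
      then show ?thesis using card red by (auto simp: D_def)
    qed
    have sub: "\<kappa> ` F \<subseteq> (SIGMA d:C. primitive_reps d Q H) \<times> {- K..K}"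
    proof
      fix y assume "y \<in> \<kappa> ` F"
      then obtain p where p: "p \<in> F" "y = \<kappa> p" by blast
      obtain p0 p1 p2 p3 where pp: "p = (p0, p1, p2, p3)" by (cases p)
      have near: "Q \<le> real_of_int p0" "real_of_int p0 < 2 * Q" "\<bar>p1\<bar> \<le> K * p0"
        "\<bar>real_of_int (hess (p0, p1, p2, p3))\<bar> \<le> H"
        using p F(2) by (auto simp: near_points_def pp)
      have reps: "(m p, n p) \<in> primitive_reps (c p) Q H"
        using near code[OF p(1)] unfolding primitive_reps_def pp by blast
      have "p0 > 0" using near \<open>Q > 0\<close> by linarith
      have "- K * p0 \<le> p1" "p1 \<le> K * p0" using near(3) by (simp_all add: abs_le_iff)
      then have "(- K * p0) div p0 \<le> p1 div p0" "p1 div p0 \<le> (K * p0) div p0"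
        using \<open>p0 > 0\<close> zdiv_mono1 by blast+
      then have "- K \<le> p1 div p0" "p1 div p0 \<le> K"
        using \<open>p0 > 0\<close> nonzero_mult_div_cancel_right[of p0 "- K"] nonzero_mult_div_cancel_right[of p0 K] by linarith+
      then show "y \<in> (SIGMA d:C. primitive_reps d Q H) \<times> {- K..K}"
        using p reps by (simp add: \<kappa>_def pp C_def)
    qed
    have "card F = card (\<kappa> ` F)" using \<open>inj_on \<kappa> F\<close> by (simp add: card_image)
    also have "\<dots> \<le> card ((SIGMA d:C. primitive_reps d Q H) \<times> {- K..K})"
      using sub C C_props by (intro card_mono finite_cartesian_product finite_SigmaI) auto
    also have "\<dots> = (\<Sum>d\<in>C. card (primitive_reps d Q H)) * nat (2 * K + 1)"
      using C C_props by (simp add: card_cartesian_product card_SigmaI)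
    finally have "real (card F) \<le> real ((\<Sum>d\<in>C. card (primitive_reps d Q H)) * nat (2 * K + 1))"
      by (simp only: of_nat_le_iff)
    also have "\<dots> = (\<Sum>d\<in>C. real (card (primitive_reps d Q H))) * (2 * real_of_int K + 1)"
      using assms(2) by simp
    also have "\<dots> \<le> (\<Sum>d\<in>C. 21 * 5 powr (1/2 + e) * H powr (2 + 2 * e) * real_of_int (disc d) powr - (1 + e)) * (2 * real_of_int K + 1)"
    proof (intro mult_right_mono sum_mono)
      show "0 \<le> 2 * real_of_int K + 1" using assms(2) by simp
    qed (use C_props in blast)
    also have "\<dots> \<le> (21 * 5 powr (1/2 + e) * H powr (2 + 2 * e) * B) * (2 * real_of_int K + 1)"
      unfolding sum_distrib_left[symmetric]
    proof (intro mult_right_mono mult_left_mono B(2))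
      show "0 \<le> 2 * real_of_int K + 1" using assms(2) by simp
    qed (use C C_props in \<open>blast | simp\<close>)+
    finally show ?thesis by (simp add: B'_def mult_ac)
  qed
  show thesis
  proof (rule that)
    fix Q H :: real assume QH: "Q > 0" "H \<ge> 1" "4 * H^3 \<le> Q^2"
    have "finite (near_points K Q H) \<and> card (near_points K Q H) \<le> nat \<lfloor>B' * H powr (2 + 2 * e)\<rfloor>"
      using card_le[OF QH] by (intro finite_if_finite_subsets_card_bdd) (simp add: le_nat_floor)
    then have "finite (near_points K Q H)" by blast
    then show "finite (near_points K Q H) \<and> real (card (near_points K Q H)) \<le> B' * H powr (2 + 2 * e)"
      using card_le[OF QH] by blast
  qed
qed

section \<open>Limsup sets\<close>

text \<open>With a = -A = k^2 and G = 2 k^3 the form satisfies q^2 f = (q X + (p1 - k) Y)^2 (q X +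
  (p1 + 2 k) Y), and \<beta> / \<alpha> is (p1 - k) / q in lowest terms. Integrality of p2 and p3
  makes \<alpha> divide p1 + k and \<alpha>^2 divide p1 + 2 k, hence \<alpha> divides k. For k = 0
  the root is triple and \<alpha>^2 divides the cancelled gcd.\<close>

lemma repeated_root:
  assumes "q > 0" and disc0: "disc (q, p1, p2, p3) = 0"
  obtains k \<alpha> \<beta> :: int where "hess (q, p1, p2, p3) = - (k^2)" "\<alpha> > 0" "q * \<beta> = \<alpha> * (p1 - k)"
    "k \<noteq> 0 \<Longrightarrow> \<alpha> \<le> \<bar>k\<bar>" "k = 0 \<Longrightarrow> \<alpha>^3 \<le> q"
proof -
  define a where "a = p1^2 - q * p2"
  define G where "G = q^2 * p3 - 3 * q * p1 * p2 + 2 * p1^3"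
  have "G^2 + 4 * (q * p2 - p1^2)^3 = 0"
    using syzygy[of q p1 p2 p3] unfolding disc0 G_def by simp
  moreover have "(q * p2 - p1^2)^3 = - (a^3)" unfolding a_def by algebra
  ultimately have Ga: "G^2 = 4 * a^3" by linarith
  then have "even (G^2)" by simp
  then have "even G" by simp
  then obtain g where g: "G = 2 * g" by blast
  have ga: "g^2 = a^3" using Ga by (simp add: g)
  \<comment> \<open>An integer whose cube is a square is itself a square.\<close>
  obtain k where k: "a = k^2" "g = k^3"
  proof (cases "a = 0")
    case True
    then show ?thesis using that[of 0] ga by simp
  next
    case False
    have "a^2 dvd g^2" unfolding ga by (simp add: power2_eq_square power3_eq_cube)
    then obtain k where k: "g = a * k" by auto
    then have "a^2 * k^2 = a^2 * a" using ga by (simp add: power_mult_distrib power2_eq_square power3_eq_cube)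
    then have "k^2 = a" using False by simp
    then show ?thesis using that[of k] k by (simp add: power2_eq_square power3_eq_cube)
  qed
  have e2: "q * p2 = (p1 - k) * (p1 + k)" using k(1) unfolding a_def by algebra
  have e3: "q^2 * p3 = (p1 - k)^2 * (p1 + 2 * k)"
    using k g e2 unfolding G_def by algebra
  have "gcd q (p1 - k) \<noteq> 0" using \<open>q > 0\<close> by simp
  then obtain \<alpha> \<beta> where ab: "q = \<alpha> * gcd q (p1 - k)" "p1 - k = \<beta> * gcd q (p1 - k)" "coprime \<alpha> \<beta>"
    using gcd_coprime_exists by blast
  define d where "d = gcd q (p1 - k)"
  have d: "q = \<alpha> * d" "p1 - k = \<beta> * d" using ab by (simp_all only: d_def)
  have "d > 0" using \<open>q > 0\<close> by (simp add: d_def)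
  then have "\<alpha> > 0" using \<open>q > 0\<close> d(1) by (simp add: zero_less_mult_iff)
  have "d * (\<alpha> * p2) = d * (\<beta> * (p1 + k))" using e2 unfolding d by (simp add: mult_ac)
  then have "\<alpha> * p2 = \<beta> * (p1 + k)" using \<open>d > 0\<close> by simp
  then have "\<alpha> dvd \<beta> * (p1 + k)" by (metis dvd_triv_left)
  then have 1: "\<alpha> dvd p1 + k" using ab(3) by (simp add: coprime_dvd_mult_right_iff)
  have "d^2 * (\<alpha>^2 * p3) = d^2 * (\<beta>^2 * (p1 + 2 * k))" using e3 unfolding d by (simp add: power_mult_distrib mult_ac)
  then have "\<alpha>^2 * p3 = \<beta>^2 * (p1 + 2 * k)" using \<open>d > 0\<close> by simp
  then have "\<alpha>^2 dvd \<beta>^2 * (p1 + 2 * k)" by (metis dvd_triv_left)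
  moreover have "coprime (\<alpha>^2) (\<beta>^2)" using ab(3) by simp
  ultimately have 2: "\<alpha>^2 dvd p1 + 2 * k" by (simp add: coprime_dvd_mult_right_iff)
  then have "\<alpha> dvd p1 + 2 * k" by (metis dvd_mult_left power2_eq_square)
  then have "\<alpha> dvd (p1 + 2 * k) - (p1 + k)" using 1 dvd_diff by blast
  then have "\<alpha> dvd k" by simp
  show thesis
  proof (rule that[of k \<alpha> \<beta>])
    show "hess (q, p1, p2, p3) = - (k^2)" using k(1) by (simp add: a_def)
    show "q * \<beta> = \<alpha> * (p1 - k)" unfolding d by (simp add: mult_ac)
    show "\<alpha> \<le> \<bar>k\<bar>" if "k \<noteq> 0" using \<open>\<alpha> dvd k\<close> that by (simp add: zdvd_imp_le)
    show "\<alpha>^3 \<le> q" if "k = 0"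
    proof -
      have "\<alpha>^2 dvd \<beta> * d" using 2 d(2) that by simp
      moreover have "coprime (\<alpha>^2) \<beta>" using ab(3) by simp
      ultimately have "\<alpha>^2 dvd d" by (simp add: coprime_dvd_mult_right_iff)
      then have "\<alpha>^2 \<le> d" using \<open>d > 0\<close> by (simp add: zdvd_imp_le)
      then have "\<alpha> * \<alpha>^2 \<le> \<alpha> * d" using \<open>\<alpha> > 0\<close> by (intro mult_left_mono) auto
      then show ?thesis unfolding d(1) by (simp add: power2_eq_square power3_eq_cube)
    qed
  qed fact
qed

text \<open>The factor 2 leaves room for two errors, from x to p1 / q and from there to b / a.
  Fractions need not be in lowest terms, which admits rational x.\<close>

definition rational_limsup :: "int \<Rightarrow> real \<Rightarrow> real set" where
  "rational_limsup K w = {x. infinite {a::nat. 1 \<le> a \<and> (\<exists>b::int. \<bar>b\<bar> \<le> K * int a \<and> \<bar>x - b / a\<bar> \<le> 2 * real a powr - w)}}"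

text \<open>There are O(a) centres with denominator a and radius 2 a^(-w), so the series to sum is
  that of a^(1 - s w).\<close>

lemma hausdorff_null_rational_limsup:
  assumes "s > 0" "2 < s * w" "K \<ge> 0"
  shows "hausdorff_null s (rational_limsup K w)"
proof -
  define F where "F = (\<lambda>a::nat. (\<lambda>b::int. b / real a) ` {- (K * int a)..K * int a})"
  define d where "d = (\<lambda>a::nat. 2 * real a powr - w)"
  have card: "real (card (F a)) \<le> (2 * real_of_int K + 1) * real a" if "a \<ge> 1" for a
  proof -
    have "card (F a) \<le> card {- (K * int a)..K * int a}" unfolding F_def by (rule card_image_le) simp
    then have "int (card (F a)) \<le> 2 * (K * int a) + 1"
      using mult_nonneg_nonneg[OF assms(3), of "int a"] by simp
    then have "real_of_int (int (card (F a))) \<le> real_of_int (2 * (K * int a) + 1)" by (simp only: of_int_le_iff)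
    then show ?thesis using that by (simp add: algebra_simps)
  qed
  have "hausdorff_null s {x. infinite {a. \<exists>r\<in>F a. dist x r \<le> d a}}"
  proof (rule hausdorff_cantelli)
    show "summable (\<lambda>a. real (card (F a)) * (2 * d a) powr s)"
    proof (rule summable_comparison_test)
      show "summable (\<lambda>a. (2 * real_of_int K + 1) * 4 powr s * real a powr (1 - s * w))"
        using assms by (intro summable_mult) (simp add: summable_real_powr_iff)
      have "norm (real (card (F a)) * (2 * d a) powr s) \<le> (2 * real_of_int K + 1) * 4 powr s * real a powr (1 - s * w)"
        if "a \<ge> 1" for a
      proof -
        have "(2 * d a) powr s = 4 powr s * (real a powr - w) powr s"
          by (simp add: d_def flip: powr_mult)
        also have "(real a powr - w) powr s = real a powr (- (s * w))"
          by (simp add: powr_powr mult.commute)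
        finally have "norm (real (card (F a)) * (2 * d a) powr s) = real (card (F a)) * (4 powr s * real a powr (- (s * w)))"
          by simp
        also have "\<dots> \<le> ((2 * real_of_int K + 1) * real a) * (4 powr s * real a powr (- (s * w)))"
          using card[OF that] by (intro mult_right_mono) auto
        also have "((2 * real_of_int K + 1) * real a) * (4 powr s * real a powr (- (s * w)))
            = (2 * real_of_int K + 1) * 4 powr s * (real a powr 1 * real a powr (- (s * w)))"
          using that by simp
        also have "real a powr 1 * real a powr (- (s * w)) = real a powr (1 - s * w)"
          by (simp only: powr_add[symmetric]) simp
        finally show ?thesis .
      qed
      then show "\<exists>N. \<forall>a\<ge>N. norm (real (card (F a)) * (2 * d a) powr s) \<le> (2 * real_of_int K + 1) * 4 powr s * real a powr (1 - s * w)"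
        by blast
    qed
  qed (use assms in \<open>auto simp: F_def d_def\<close>)
  moreover have "rational_limsup K w \<subseteq> {x. infinite {a. \<exists>r\<in>F a. dist x r \<le> d a}}"
  proof safe
    fix x assume "x \<in> rational_limsup K w" "finite {a. \<exists>r\<in>F a. dist x r \<le> d a}"
    moreover have "{a::nat. 1 \<le> a \<and> (\<exists>b::int. \<bar>b\<bar> \<le> K * int a \<and> \<bar>x - b / a\<bar> \<le> 2 * real a powr - w)}
        \<subseteq> {a. \<exists>r\<in>F a. dist x r \<le> d a}"
      by (auto simp: F_def d_def dist_real_def abs_le_iff)
    ultimately show False unfolding rational_limsup_def using finite_subset by blast
  qed
  ultimately show ?thesis by (rule hausdorff_null_subset)
qed

text \<open>Indexed by dyadic blocks of q; (2 * 2^k)^(1 - l) dominates q^(1 - l) throughout the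
  block.\<close>

definition near_limsup :: "int \<Rightarrow> real \<Rightarrow> real set" where
  "near_limsup K l = {x. infinite {k::nat. \<exists>p0 p1 p2 p3. (p0, p1, p2, p3) \<in> near_points K (2^k) ((2 * 2^k) powr (1 - l)) \<and>
     \<bar>x - p1 / p0\<bar> \<le> (2^k) powr - (1 + l)}}"

lemma hausdorff_null_near_limsup:
  assumes l: "1/2 \<le> l" "l < 1" and s: "s > 0" "2 - 2 * l < s * (1 + l)" and "K \<ge> 0"
  shows "hausdorff_null s (near_limsup K l)"
proof -
  \<comment> \<open>Chosen so that the loss 2 e (1 - l) uses up half of the gap s (1 + l) - (2 - 2
    l); the other half makes the exponent \<theta> negative.\<close>
  define e where "e = (s * (1 + l) - (2 - 2 * l)) / (4 * (1 - l))"
  have "e > 0" using l s by (simp add: e_def)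
  define \<theta> where "\<theta> = (1 - l) * (2 + 2 * e) - s * (1 + l)"
  have "4 * (1 - l) * e = s * (1 + l) - (2 - 2 * l)" using l by (simp add: e_def)
  then have "\<theta> < 0" using s by (simp add: \<theta>_def algebra_simps)
  define H where "H = (\<lambda>k::nat. (2 * 2^k :: real) powr (1 - l))"
  \<comment> \<open>Small blocks are dropped: 4 H^3 <= Q^2 is derived from R^(1/2) >= 16 for R = 2
    Q, that is, from k >= 7.\<close>
  define F where "F = (\<lambda>k::nat. if k < 7 then {} else (\<lambda>(p0 :: int, p1 :: int, p2 :: int, p3 :: int). p1 / p0 :: real) ` near_points K (2^k) (H k))"
  define d where "d = (\<lambda>k::nat. (2^k :: real) powr - (1 + l))"
  obtain B where B: "\<And>Q H. Q > 0 \<Longrightarrow> H \<ge> 1 \<Longrightarrow> 4 * H^3 \<le> Q^2 \<Longrightarrow>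
    finite (near_points K Q H) \<and> real (card (near_points K Q H)) \<le> B * H powr (2 + 2 * e)"
    using card_near_points_le[OF \<open>e > 0\<close> \<open>K \<ge> 0\<close>] by metis
  have near: "finite (near_points K (2^k) (H k)) \<and> real (card (near_points K (2^k) (H k))) \<le> B * H k powr (2 + 2 * e)"
    if "k \<ge> 7" for k
  proof (rule B)
    define R :: real where "R = 2 * 2^k"
    have "(2::real)^7 \<le> 2^k" using that by (intro power_increasing) auto
    then have R: "256 \<le> R" by (simp add: R_def)
    show "1 \<le> H k" using l R by (simp add: H_def ge_one_powr_ge_zero flip: R_def)
    have "H k ^ 3 = R powr (3 * (1 - l))"
      using R by (simp add: H_def powr_powr mult.commute flip: R_def powr_numeral)
    also have "\<dots> \<le> R powr (3/2)" using l R by (intro powr_mono) auto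
    finally have H3: "H k ^ 3 \<le> R powr (3/2)" .
    have "16 * R powr (3/2) = 256 powr (1/2) * R powr (3/2)" by (simp add: powr_half_sqrt real_sqrt_unique[of 16])
    also have "\<dots> \<le> R powr (1/2) * R powr (3/2)"
      using R by (intro mult_right_mono powr_mono2) auto
    also have "\<dots> = R^2" using R by (simp add: powr_add[symmetric])
    finally have "16 * H k ^ 3 \<le> R^2" using H3 by linarith
    then show "4 * H k ^ 3 \<le> (2^k)^2" by (simp add: R_def power_mult_distrib)
  qed simp
  have "hausdorff_null s {x. infinite {k. \<exists>r\<in>F k. dist x r \<le> d k}}"
  proof (rule hausdorff_cantelli)
    show "summable (\<lambda>k. real (card (F k)) * (2 * d k) powr s)"
    proof (rule summable_comparison_test)
      have "2 powr \<theta> < 2 powr 0" using \<open>\<theta> < 0\<close> by (intro powr_less_mono) auto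
      then show "summable (\<lambda>k. \<bar>B\<bar> * 2 powr ((1 - l) * (2 + 2 * e)) * 2 powr s * (2 powr \<theta>)^k)"
        by (intro summable_mult summable_geometric) simp
      have "norm (real (card (F k)) * (2 * d k) powr s) \<le> \<bar>B\<bar> * 2 powr ((1 - l) * (2 + 2 * e)) * 2 powr s * (2 powr \<theta>)^k"
        if "k \<ge> 7" for k
      proof -
        define Q :: real where "Q = 2^k"
        have "Q > 0" by (simp add: Q_def)
        have "card (F k) \<le> card (near_points K (2^k) (H k))"
          using that near unfolding F_def by (simp add: card_image_le)
        then have "real (card (F k)) \<le> B * H k powr (2 + 2 * e)" using near[OF that] by linarith
        also have "\<dots> \<le> \<bar>B\<bar> * H k powr (2 + 2 * e)" by (intro mult_right_mono) auto
        also have "H k powr (2 + 2 * e) = 2 powr ((1 - l) * (2 + 2 * e)) * Q powr ((1 - l) * (2 + 2 * e))"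
          by (simp only: H_def powr_powr powr_mult Q_def)
        finally have c: "real (card (F k)) \<le> \<bar>B\<bar> * (2 powr ((1 - l) * (2 + 2 * e)) * Q powr ((1 - l) * (2 + 2 * e)))" .
        have "(2 * d k) powr s = 2 powr s * Q powr (- (1 + l) * s)"
          by (simp only: d_def powr_powr powr_mult Q_def)
        then have "norm (real (card (F k)) * (2 * d k) powr s) = real (card (F k)) * (2 powr s * Q powr (- (1 + l) * s))"
          by simp
        also have "\<dots> \<le> (\<bar>B\<bar> * (2 powr ((1 - l) * (2 + 2 * e)) * Q powr ((1 - l) * (2 + 2 * e)))) * (2 powr s * Q powr (- (1 + l) * s))"
          using c by (intro mult_right_mono) auto
        also have "\<dots> = \<bar>B\<bar> * 2 powr ((1 - l) * (2 + 2 * e)) * 2 powr s * (Q powr ((1 - l) * (2 + 2 * e)) * Q powr (- (1 + l) * s))"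
          by (simp only: mult_ac)
        also have "Q powr ((1 - l) * (2 + 2 * e)) * Q powr (- (1 + l) * s) = Q powr \<theta>"
          unfolding powr_add[symmetric] \<theta>_def by (simp add: algebra_simps)
        also have "Q powr \<theta> = (2 powr \<theta>)^k"
          by (simp add: Q_def powr_powr mult.commute flip: powr_realpow)
        finally show ?thesis .
      qed
      then show "\<exists>N. \<forall>k\<ge>N. norm (real (card (F k)) * (2 * d k) powr s) \<le> \<bar>B\<bar> * 2 powr ((1 - l) * (2 + 2 * e)) * 2 powr s * (2 powr \<theta>)^k"
        by blast
    qed
    show "finite (F k)" for k using near by (simp add: F_def)
  qed (use s in \<open>auto simp: d_def\<close>)
  moreover have "near_limsup K l \<subseteq> {x. infinite {k. \<exists>r\<in>F k. dist x r \<le> d k}}"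
  proof
    fix x assume x: "x \<in> near_limsup K l"
    have "\<exists>k\<ge>m. \<exists>r\<in>F k. dist x r \<le> d k" for m
    proof -
      obtain k p0 p1 p2 p3 where k: "k \<ge> max m 7" "(p0, p1, p2, p3) \<in> near_points K (2^k) (H k)"
        "\<bar>x - p1 / p0\<bar> \<le> (2^k) powr - (1 + l)"
        using x unfolding near_limsup_def infinite_nat_iff_unbounded_le mem_Collect_eq H_def by blast
      have "p1 / p0 \<in> F k" unfolding F_def using k by force
      then show ?thesis using k by (intro exI[of _ k]) (auto simp: d_def dist_real_def)
    qed
    then show "x \<in> {x. infinite {k. \<exists>r\<in>F k. dist x r \<le> d k}}"
      unfolding infinite_nat_iff_unbounded_le by blast
  qed
  ultimately show ?thesis by (rule hausdorff_null_subset)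
qed

section \<open>Good approximations to a point of the curve\<close>

text \<open>The strict gap between l' and l is kept because it later absorbs constants depending on
  x.\<close>

lemma lambda_exponent_gt_imp:
  fixes x :: real
  assumes "lambda_exponent 3 x > ereal l"
  obtains l' where "l' > l" "infinite {q::nat. q > 0 \<and> (\<exists>p1 p2 p3. \<bar>q * x - real_of_int p1\<bar> \<le> real q powr - l' \<and>
    \<bar>q * x^2 - real_of_int p2\<bar> \<le> real q powr - l' \<and> \<bar>q * x^3 - real_of_int p3\<bar> \<le> real q powr - l')}"
proof -
  obtain l' where l': "l' > l" and inf: "infinite {q :: nat. q > 0 \<and>
      Max ((\<lambda>i. dist_nearest_int (real q * x ^ i)) ` {1..3}) \<le> real q powr (- l')}"
    using assms unfolding lambda_exponent_def less_SUP_iff by auto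
  have near: "\<exists>p::int. \<bar>y - p\<bar> = dist_nearest_int y" for y
  proof -
    obtain z where "z \<in> \<int>" "infdist y \<int> = dist y z"
      using infdist_attains_inf[of "\<int> :: real set" y] closed_Ints by (metis Ints_0 empty_iff)
    then show ?thesis by (auto simp: dist_nearest_int_def dist_real_def elim!: Ints_cases)
  qed
  have near': "\<exists>p::int. \<bar>y - p\<bar> \<le> e" if "dist_nearest_int y \<le> e" for y e
    using near[of y] that by metis
  have "{q :: nat. q > 0 \<and> Max ((\<lambda>i. dist_nearest_int (real q * x ^ i)) ` {1..3}) \<le> real q powr (- l')}
    \<subseteq> {q::nat. q > 0 \<and> (\<exists>p1 p2 p3. \<bar>q * x - real_of_int p1\<bar> \<le> real q powr - l' \<and>
    \<bar>q * x^2 - real_of_int p2\<bar> \<le> real q powr - l' \<and> \<bar>q * x^3 - real_of_int p3\<bar> \<le> real q powr - l')}"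
  proof safe
    fix q :: nat
    assume "Max ((\<lambda>i. dist_nearest_int (real q * x ^ i)) ` {1..3}) \<le> real q powr (- l')"
    then have "dist_nearest_int (real q * x ^ i) \<le> real q powr (- l')" if "i \<in> {1..3}" for i
      using that by simp
    from this[of 1] this[of 2] this[of 3]
    have "dist_nearest_int (real q * x) \<le> real q powr (- l')" "dist_nearest_int (real q * x^2) \<le> real q powr (- l')"
      "dist_nearest_int (real q * x^3) \<le> real q powr (- l')" by simp_all
    then show "\<exists>p1 p2 p3. \<bar>q * x - real_of_int p1\<bar> \<le> real q powr - l' \<and>
        \<bar>q * x^2 - real_of_int p2\<bar> \<le> real q powr - l' \<and> \<bar>q * x^3 - real_of_int p3\<bar> \<le> real q powr - l'"
      using near' by blast
  qed
  then show thesis using that[OF l'] inf finite_subset by blast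
qed

text \<open>The 5 is 1 + 4, from D = B^2 - 4 A C with all three minors bounded by q^(1 - l).\<close>

definition good_approx :: "real \<Rightarrow> real \<Rightarrow> int \<Rightarrow> int \<Rightarrow> int \<Rightarrow> int \<Rightarrow> bool" where
  "good_approx x l q p1 p2 p3 \<longleftrightarrow> \<bar>x - p1 / q\<bar> \<le> real_of_int q powr - (1 + l) \<and>
     \<bar>real_of_int (hess (q, p1, p2, p3))\<bar> \<le> real_of_int q powr (1 - l) \<and>
     real_of_int (disc (q, p1, p2, p3)) \<le> 5 * (real_of_int q powr (1 - l))^2 \<and> 0 \<le> disc (q, p1, p2, p3)"

text \<open>The minors vanish at q (1, x, x^2, x^3), so only terms linear in the errors, of size q
  \<epsilon>, and quadratic terms, at most \<epsilon>^2 <= q \<epsilon>, survive. The factor in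
  \<open>E\<close> is a common majorant of the three coefficients.\<close>

lemma minors_bound:
  fixes q x d1 d2 d3 \<epsilon> :: real
  assumes "q \<ge> 1" "0 \<le> \<epsilon>" "\<epsilon> \<le> 1" "\<bar>d1\<bar> \<le> \<epsilon>" "\<bar>d2\<bar> \<le> \<epsilon>" "\<bar>d3\<bar> \<le> \<epsilon>"
  defines "p1 \<equiv> q * x + d1" and "p2 \<equiv> q * x^2 + d2" and "p3 \<equiv> q * x^3 + d3"
  defines "E \<equiv> 6 * (1 + \<bar>x\<bar>)^3 * (q * \<epsilon>)"
  shows "\<bar>q * p2 - p1^2\<bar> \<le> E" "\<bar>q * p3 - p1 * p2\<bar> \<le> E" "\<bar>p1 * p3 - p2^2\<bar> \<le> E"
proof -
  define y where "y = \<bar>x\<bar>"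
  define t where "t = q * \<epsilon>"
  have lin: "q * c * d \<le> \<bar>c\<bar> * t" "- (\<bar>c\<bar> * t) \<le> q * c * d" if "\<bar>d\<bar> \<le> \<epsilon>" for c d
  proof -
    have "\<bar>q * c * d\<bar> = \<bar>c\<bar> * (q * \<bar>d\<bar>)" using assms(1) by (simp add: abs_mult)
    also have "\<dots> \<le> \<bar>c\<bar> * t" using that assms(1) unfolding t_def by (intro mult_left_mono) auto
    finally show "q * c * d \<le> \<bar>c\<bar> * t" "- (\<bar>c\<bar> * t) \<le> q * c * d" by (simp_all only: abs_le_iff) linarith
  qed
  have quad: "d * d' \<le> t" "- t \<le> d * d'" if "\<bar>d\<bar> \<le> \<epsilon>" "\<bar>d'\<bar> \<le> \<epsilon>" for d d'
  proof -
    have "\<bar>d\<bar> * \<bar>d'\<bar> \<le> t" using that assms(1-3) unfolding t_def by (intro mult_mono) auto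
    then have "\<bar>d * d'\<bar> \<le> t" by (simp only: abs_mult)
    then show "d * d' \<le> t" "- t \<le> d * d'" by (simp_all only: abs_le_iff) linarith
  qed
  have y: "0 \<le> y" "0 \<le> y^2" "0 \<le> y^3" by (auto simp: y_def)
  have E: "c * t \<le> E" if "c \<le> 6 + 18 * y + 18 * y^2 + 6 * y^3" for c
  proof -
    have "6 * (1 + y)^3 = 6 + 18 * y + 18 * y^2 + 6 * y^3"
      by (simp add: algebra_simps power2_eq_square power3_eq_cube)
    then show ?thesis using that assms(1,2) unfolding E_def t_def y_def[symmetric] by (intro mult_right_mono) auto
  qed
  have "q * p2 - p1^2 = q * 1 * d2 - 2 * (q * x * d1) - d1 * d1"
    unfolding p1_def p2_def by (simp add: algebra_simps power2_eq_square)
  then have "\<bar>q * p2 - p1^2\<bar> \<le> (2 + 2 * y) * t"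
    using lin[OF assms(5), of 1, unfolded abs_one] lin[OF assms(4), of x, folded y_def] quad[OF assms(4,4)]
    unfolding distrib_right by (intro abs_leI; linarith)
  also have "\<dots> \<le> E" using y by (intro E) linarith
  finally show "\<bar>q * p2 - p1^2\<bar> \<le> E" .
  have "q * p3 - p1 * p2 = q * 1 * d3 - q * x * d2 - q * x^2 * d1 - d1 * d2"
    unfolding p1_def p2_def p3_def by (simp add: algebra_simps power2_eq_square power3_eq_cube)
  then have "\<bar>q * p3 - p1 * p2\<bar> \<le> (2 + y + y^2) * t"
    using lin[OF assms(6), of 1, unfolded abs_one] lin[OF assms(5), of x, folded y_def]
      lin[OF assms(4), of "x^2", unfolded power_abs, folded y_def] quad[OF assms(4,5)]
    unfolding distrib_right by (intro abs_leI; linarith)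
  also have "\<dots> \<le> E" using y by (intro E) linarith
  finally show "\<bar>q * p3 - p1 * p2\<bar> \<le> E" .
  have "p1 * p3 - p2^2 = q * x * d3 + q * x^3 * d1 - 2 * (q * x^2 * d2) + d1 * d3 - d2 * d2"
    unfolding p1_def p2_def p3_def by (simp add: algebra_simps power2_eq_square power3_eq_cube)
  then have "\<bar>p1 * p3 - p2^2\<bar> \<le> (2 + y + 2 * y^2 + y^3) * t"
    using lin[OF assms(6), of x, folded y_def] lin[OF assms(4), of "x^3", unfolded power_abs, folded y_def]
      lin[OF assms(5), of "x^2", unfolded power_abs, folded y_def] quad[OF assms(4,6)] quad[OF assms(5,5)]
    unfolding distrib_right by (intro abs_leI; linarith)
  also have "\<dots> \<le> E" using y by (intro E) linarith
  finally show "\<bar>p1 * p3 - p2^2\<bar> \<le> E" .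
qed

lemma good_approxI:
  fixes q :: nat and p1 p2 p3 :: int and x :: real
  assumes l: "1/2 \<le> l" "l < l'" and q: "17 \<le> real q" "6 * (1 + \<bar>x\<bar>)^3 \<le> real q powr (l' - l)"
    and p: "\<bar>q * x - p1\<bar> \<le> real q powr - l'" "\<bar>q * x^2 - p2\<bar> \<le> real q powr - l'" "\<bar>q * x^3 - p3\<bar> \<le> real q powr - l'"
  shows "good_approx x l (int q) p1 p2 p3"
proof -
  define \<epsilon> where "\<epsilon> = real q powr - l'"
  define h where "h = real q powr (1 - l)"
  define A B C where "A = real q * p2 - (real_of_int p1)^2" and "B = real q * p3 - real_of_int p1 * p2" and "C = real_of_int p1 * p3 - (real_of_int p2)^2"
  have "\<epsilon> \<le> real q powr 0" unfolding \<epsilon>_def using l q by (intro powr_mono) auto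
  then have \<epsilon>: "0 \<le> \<epsilon>" "\<epsilon> \<le> 1" using q by (auto simp: \<epsilon>_def)
  have "real q * \<epsilon> = real q powr (1 - l')"
    using q by (simp add: \<epsilon>_def powr_diff powr_minus divide_inverse)
  then have "6 * (1 + \<bar>x\<bar>)^3 * (real q * \<epsilon>) \<le> real q powr (l' - l) * real q powr (1 - l')"
    using q by (simp add: mult_right_mono)
  also have "\<dots> = h" by (simp add: h_def powr_add[symmetric])
  finally have E: "6 * (1 + \<bar>x\<bar>)^3 * (real q * \<epsilon>) \<le> h" .
  define d1 d2 d3 where "d1 = p1 - real q * x" and "d2 = p2 - real q * x^2" and "d3 = p3 - real q * x^3"
  have pd: "real_of_int p1 = real q * x + d1" "real_of_int p2 = real q * x^2 + d2" "real_of_int p3 = real q * x^3 + d3"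
    by (simp_all add: d1_def d2_def d3_def)
  have d: "\<bar>d1\<bar> \<le> \<epsilon>" "\<bar>d2\<bar> \<le> \<epsilon>" "\<bar>d3\<bar> \<le> \<epsilon>"
    using p unfolding d1_def d2_def d3_def \<epsilon>_def by linarith+
  have "1 \<le> real q" using q by linarith
  note minors_bound[OF this \<epsilon> d, of x]
  then have ABC: "\<bar>A\<bar> \<le> h" "\<bar>B\<bar> \<le> h" "\<bar>C\<bar> \<le> h" using E unfolding A_def B_def C_def pd by linarith+
  define D where "D = disc (int q, p1, p2, p3)"
  have hess: "real_of_int (hess (int q, p1, p2, p3)) = A" by (simp add: A_def)
  have D: "real_of_int D = B^2 - 4 * A * C" by (simp add: D_def A_def B_def C_def)
  have "\<bar>B\<bar>^2 \<le> h^2" using ABC by (intro power_mono) auto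
  moreover have "\<bar>A\<bar> * \<bar>C\<bar> \<le> h * h" using ABC by (intro mult_mono) auto
  ultimately have D5: "real_of_int D \<le> 5 * h^2"
    unfolding D using abs_ge_minus_self[of "A * C"] by (simp add: abs_mult power2_eq_square)
  \<comment> \<open>D <= -1 would give q^2 <= 4 |A|^3 <= 4 q^(3/2) by the syzygy, impossible for q >
    16.\<close>
  have "0 \<le> D"
  proof (rule ccontr)
    assume "\<not> 0 \<le> D"
    define G where "G = (int q)^2 * p3 - 3 * int q * p1 * p2 + 2 * p1^3"
    have "real_of_int ((int q)^2 * D) = real_of_int (G^2 + 4 * (int q * p2 - p1^2)^3)"
      using syzygy[of "int q" p1 p2 p3] by (simp only: D_def G_def)
    then have "(real q)^2 * real_of_int D = (real_of_int G)^2 + 4 * A^3"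
      by (simp add: A_def)
    moreover have "(real q)^2 * real_of_int D \<le> (real q)^2 * (- 1)"
      using \<open>\<not> 0 \<le> D\<close> by (intro mult_left_mono) auto
    ultimately have "(real q)^2 \<le> - (4 * A^3)" using zero_le_power2[of "real_of_int G"] by linarith
    also have "\<dots> \<le> 4 * \<bar>A\<bar>^3" using abs_ge_minus_self[of "A^3"] by (simp add: power_abs)
    also have "\<dots> \<le> 4 * h^3" using ABC by (intro mult_left_mono power_mono) auto
    also have "h^3 = real q powr (3 * (1 - l))"
      using q by (simp add: h_def powr_powr mult.commute flip: powr_numeral)
    also have "4 * \<dots> \<le> 4 * real q powr (3/2)" using l q by (intro mult_left_mono powr_mono) auto
    also have "\<dots> < real q powr (1/2) * real q powr (3/2)"
    proof (rule mult_strict_right_mono)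
      have "4 = sqrt 16" by (rule real_sqrt_unique[symmetric]) auto
      also have "\<dots> < sqrt (real q)" using q by (intro real_sqrt_less_mono) auto
      finally show "4 < real q powr (1/2)" using q by (simp add: powr_half_sqrt)
    qed (use q in auto)
    also have "\<dots> = (real q)^2" using q by (simp add: powr_add[symmetric])
    finally show False by simp
  qed
  moreover have "\<bar>x - p1 / q\<bar> \<le> real q powr - (1 + l)"
  proof -
    have "\<bar>x - p1 / q\<bar> = \<bar>q * x - p1\<bar> / q"
    proof -
      have "x - p1 / q = (q * x - p1) / q" using q by (simp add: field_simps)
      then show ?thesis by (simp add: abs_divide)
    qed
    also have "\<dots> \<le> real q powr - l' / q" using p by (intro divide_right_mono) auto
    also have "\<dots> = real q powr (- l' - 1)" using q by (simp add: powr_diff)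
    also have "\<dots> \<le> real q powr - (1 + l)" using l q by (intro powr_mono) auto
    finally show ?thesis .
  qed
  ultimately show ?thesis
    unfolding good_approx_def D_def[symmetric] using ABC(1) D5 hess by (simp add: h_def)
qed

lemma infinite_good_approx:
  assumes "1/2 \<le> l" "lambda_exponent 3 x > ereal l"
  shows "infinite {q::nat. q > 0 \<and> (\<exists>p1 p2 p3. good_approx x l (int q) p1 p2 p3)}"
proof -
  obtain l' where l': "l' > l" and inf: "infinite {q::nat. q > 0 \<and> (\<exists>p1 p2 p3. \<bar>q * x - real_of_int p1\<bar> \<le> real q powr - l' \<and>
    \<bar>q * x^2 - real_of_int p2\<bar> \<le> real q powr - l' \<and> \<bar>q * x^3 - real_of_int p3\<bar> \<le> real q powr - l')}" (is "infinite ?S")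
    using lambda_exponent_gt_imp[OF assms(2)] .
  define M where "M = (6 * (1 + \<bar>x\<bar>)^3) powr (1 / (l' - l))"
  have ev: "6 * (1 + \<bar>x\<bar>)^3 \<le> real q powr (l' - l)" if "M \<le> real q" for q
  proof -
    have "0 < 6 * (1 + \<bar>x\<bar>)^3" by (simp add: add_pos_nonneg)
    then have "6 * (1 + \<bar>x\<bar>)^3 = M powr (l' - l)" using l' by (simp add: M_def powr_powr)
    also have "\<dots> \<le> real q powr (l' - l)" using that l' by (intro powr_mono2) (auto simp: M_def)
    finally show ?thesis .
  qed
  have "?S \<subseteq> {q::nat. q > 0 \<and> (\<exists>p1 p2 p3. good_approx x l (int q) p1 p2 p3)} \<union> {..nat \<lceil>max 17 M\<rceil>}"
  proof
    fix q assume q: "q \<in> ?S"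
    show "q \<in> {q::nat. q > 0 \<and> (\<exists>p1 p2 p3. good_approx x l (int q) p1 p2 p3)} \<union> {..nat \<lceil>max 17 M\<rceil>}"
    proof (cases "q \<le> nat \<lceil>max 17 M\<rceil>")
      case False
      then have "17 \<le> real q" "M \<le> real q" by linarith+
      then have "\<exists>p1 p2 p3. good_approx x l (int q) p1 p2 p3"
        using q good_approxI[OF assms(1) l'] ev by blast
      then show ?thesis using q by blast
    qed simp
  qed
  then show ?thesis using inf by (meson finite_Un finite_atMost finite_subset)
qed

text \<open>Many q can fall into one dyadic block, but unbounded q reach arbitrarily late
  blocks.\<close>

lemma near_limsupI:
  assumes l: "0 \<le> l" "l < 1" and K: "\<bar>x\<bar> + 1 \<le> real_of_int K"
    and inf: "infinite {q::nat. q > 0 \<and> (\<exists>p1 p2 p3. good_approx x l (int q) p1 p2 p3 \<and> disc (int q, p1, p2, p3) \<noteq> 0)}"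
  shows "x \<in> near_limsup K l"
  unfolding near_limsup_def infinite_nat_iff_unbounded_le mem_Collect_eq
proof
  fix m
  obtain q p1 p2 p3 where q: "q \<ge> 2^m" "q > 0" and good: "good_approx x l (int q) p1 p2 p3" "disc (int q, p1, p2, p3) \<noteq> 0"
    using inf unfolding infinite_nat_iff_unbounded_le by blast
  obtain k where k: "2^k \<le> q" "q < 2^(k + 1)" using ex_power_ivl1[of 2 q] q by auto
  then have kr: "2^k \<le> real q" "real q < 2 * 2^k"
    using of_nat_le_iff[of "2^k" q, where 'a=real] of_nat_less_iff[of q "2^(k+1)", where 'a=real] by auto
  have "(2::nat)^m < 2^(k + 1)" using k q by linarith
  then have "m < k + 1" by (rule power_less_imp_less_exp[rotated]) simp
  then have "m \<le> k" by simp
  define H where "H = (2 * 2^k :: real) powr (1 - l)"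
  have qH: "real q powr (1 - l) \<le> H" unfolding H_def using l kr by (intro powr_mono2) auto
  have "(real q powr (1 - l))^2 \<le> H^2" using qH by (intro power_mono) auto
  then have D: "real_of_int (disc (int q, p1, p2, p3)) \<le> 5 * H^2"
    using good(1) unfolding good_approx_def by simp
  have x: "\<bar>x - p1 / q\<bar> \<le> real q powr - (1 + l)" using good(1) by (simp add: good_approx_def)
  also have "\<dots> \<le> (2^k) powr - (1 + l)" using l kr by (intro powr_mono2') auto
  finally have xk: "\<bar>x - p1 / q\<bar> \<le> (2^k) powr - (1 + l)" .
  have "real q powr - (1 + l) \<le> real q powr 0" using l q by (intro powr_mono) auto
  then have "\<bar>p1 / q\<bar> \<le> real_of_int K" using x K q by simp
  then have "\<bar>real_of_int p1\<bar> \<le> K * real q" using q by (simp add: abs_divide field_simps)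
  then have "real_of_int \<bar>p1\<bar> \<le> real_of_int (K * int q)" by simp
  then have "\<bar>p1\<bar> \<le> K * int q" by (simp only: of_int_le_iff)
  then have "(int q, p1, p2, p3) \<in> near_points K (2^k) H"
    using good qH D kr unfolding near_points_def good_approx_def by (auto simp del: hess.simps disc.simps)
  then show "\<exists>n\<ge>m. \<exists>p0 p1 p2 p3. (p0, p1, p2, p3) \<in> near_points K (2^n) ((2 * 2^n) powr (1 - l)) \<and>
     \<bar>x - real_of_int p1 / real_of_int p0\<bar> \<le> (2^n) powr - (1 + l)"
    using \<open>m \<le> k\<close> xk unfolding H_def by (metis of_int_of_nat_eq)
qed

text \<open>Infinitely many q might share one root, so unbounded denominators need an argument:
  bounded ones would force x to be rational, and then its unreduced fractions serve.\<close>

lemma rational_limsupI: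
  assumes l: "0 \<le> l" "l \<le> 2/3" and K: "\<bar>x\<bar> + 2 \<le> real_of_int K"
    and inf: "infinite {q::nat. q > 0 \<and> (\<exists>p1 p2 p3. good_approx x l (int q) p1 p2 p3 \<and> disc (int q, p1, p2, p3) = 0)}"
  shows "x \<in> rational_limsup K ((1 + l) / (1 - l))"
proof -
  define w where "w = (1 + l) / (1 - l)"
  have w: "w * ((1 - l) / 2) = (1 + l) / 2" using l by (simp add: w_def)
  \<comment> \<open>For triple roots only \<alpha>^3 <= q is known; there w <= 3 (1 + l) converts
    q^(-(1 + l)) into \<alpha>^(-w).\<close>
  have "(1 + l) * 1 \<le> (1 + l) * (3 * (1 - l))" using l by (intro mult_left_mono) auto
  then have "w \<le> 3 * (1 + l)" using l by (simp add: w_def divide_le_eq algebra_simps)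
  have "w \<ge> 0" using l by (simp add: w_def)
  let ?S = "{a::nat. 1 \<le> a \<and> (\<exists>b::int. \<bar>b\<bar> \<le> K * int a \<and> \<bar>x - b / a\<bar> \<le> 2 * real a powr - w)}"
  have approx: "\<exists>a::nat. a \<in> ?S \<and> (\<exists>b::int. \<bar>x - b / a\<bar> \<le> 2 * real q powr - ((1 + l) / 2))"
    if q: "q > 0" and good: "good_approx x l (int q) p1 p2 p3" "disc (int q, p1, p2, p3) = 0" for q :: nat and p1 p2 p3
  proof -
    obtain k \<alpha> \<beta> where root: "hess (int q, p1, p2, p3) = - (k^2)" "\<alpha> > 0" "int q * \<beta> = \<alpha> * (p1 - k)"
      "k \<noteq> 0 \<Longrightarrow> \<alpha> \<le> \<bar>k\<bar>" "k = 0 \<Longrightarrow> \<alpha>^3 \<le> int q"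
      using repeated_root[of "int q" p1 p2 p3] q good(2) by auto
    have q1: "1 \<le> real q" using q by simp
    have x: "\<bar>x - p1 / q\<bar> \<le> real q powr - (1 + l)" using good(1) by (simp add: good_approx_def)
    have "real_of_int \<bar>k\<bar>^2 \<le> real q powr (1 - l)"
      using good(1) unfolding good_approx_def root(1) by simp
    also have "\<dots> = (real q powr ((1 - l) / 2))^2"
      unfolding power2_eq_square powr_add[symmetric] by simp
    finally have k: "real_of_int \<bar>k\<bar> \<le> real q powr ((1 - l) / 2)" by (rule power2_le_imp_le) simp
    then have "real_of_int \<bar>k\<bar> / q \<le> real q powr ((1 - l) / 2) / q" by (intro divide_right_mono) auto
    also have "\<dots> = real q powr ((1 - l) / 2 - 1)" using q by (simp add: powr_diff)
    also have "(1 - l) / 2 - 1 = - ((1 + l) / 2)" by (simp add: field_simps)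
    finally have kq: "real_of_int \<bar>k\<bar> / q \<le> real q powr - ((1 + l) / 2)" .
    have "real_of_int (int q * \<beta>) = real_of_int (\<alpha> * (p1 - k))" using root(3) by (simp only:)
    then have "real_of_int \<beta> / \<alpha> = (p1 - k) / q"
      using q root(2) by (simp add: frac_eq_eq mult.commute)
    then have "x - \<beta> / \<alpha> = (x - p1 / q) + k / q" by (simp add: diff_divide_distrib)
    then have xb: "\<bar>x - \<beta> / \<alpha>\<bar> \<le> real q powr - (1 + l) + real_of_int \<bar>k\<bar> / q"
      using x abs_triangle_ineq[of "x - p1 / q" "k / q"] by (simp add: abs_divide)
    have "- (1 + l) \<le> - ((1 + l) / 2)" using l by (simp add: field_simps)
    then have "real q powr - (1 + l) \<le> real q powr - ((1 + l) / 2)" using q1 by (intro powr_mono)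
    then have xq: "\<bar>x - \<beta> / \<alpha>\<bar> \<le> 2 * real q powr - ((1 + l) / 2)" using xb kq by linarith
    have x\<alpha>: "\<bar>x - \<beta> / \<alpha>\<bar> \<le> 2 * real_of_int \<alpha> powr - w"
    proof (cases "k = 0")
      case False
      \<comment> \<open>\<alpha> <= |k| <= q^((1 - l) / 2), and raising this to the power -w gives
        precisely the error exponent (1 + l) / 2.\<close>
      have "real_of_int \<alpha> \<le> real q powr ((1 - l) / 2)"
        using root(4)[OF False] k by linarith
      then have "(real q powr ((1 - l) / 2)) powr - w \<le> real_of_int \<alpha> powr - w"
        using root(2) \<open>w \<ge> 0\<close> by (intro powr_mono2') auto
      moreover have "(real q powr ((1 - l) / 2)) powr - w = real q powr - ((1 + l) / 2)"
        unfolding powr_powr w[symmetric] by (simp add: mult.commute)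
      ultimately show ?thesis using xq by linarith
    next
      case True
      have "real_of_int (\<alpha>^3) \<le> real_of_int (int q)" using root(5)[OF True] by (simp only: of_int_le_iff)
      then have "real_of_int \<alpha> powr 3 \<le> real q" using root(2) by simp
      then have "real q powr - (1 + l) \<le> (real_of_int \<alpha> powr 3) powr - (1 + l)"
        using l root(2) by (intro powr_mono2') auto
      also have "\<dots> = real_of_int \<alpha> powr - (3 * (1 + l))" unfolding powr_powr by (simp add: algebra_simps)
      also have "\<dots> \<le> real_of_int \<alpha> powr - w"
        using root(2) \<open>w \<le> 3 * (1 + l)\<close> by (intro powr_mono) auto
      finally show ?thesis using xb True powr_ge_zero[of "real_of_int \<alpha>" "- w"] by simp
    qed
    have \<alpha>: "real_of_int \<alpha> = real (nat \<alpha>)" using root(2) by simp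
    have "real_of_int \<alpha> powr - w \<le> real_of_int \<alpha> powr 0" using root(2) \<open>w \<ge> 0\<close> by (intro powr_mono) auto
    then have "\<bar>\<beta> / \<alpha>\<bar> \<le> real_of_int K" using x\<alpha> K root(2) by simp
    then have "real_of_int \<bar>\<beta>\<bar> \<le> real_of_int (K * int (nat \<alpha>))" using root(2) by (simp add: abs_divide field_simps)
    then have "\<bar>\<beta>\<bar> \<le> K * int (nat \<alpha>)" by (simp only: of_int_le_iff)
    moreover have "1 \<le> nat \<alpha>" using root(2) by simp
    ultimately show ?thesis using x\<alpha> xq unfolding \<alpha> by blast
  qed
  have "\<exists>a\<ge>m. a \<in> ?S" for m
  proof (cases "real (fact m) * x \<in> \<int>")
    case True
    then obtain b where b: "fact m * x = of_int b" by (auto elim: Ints_cases)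
    \<comment> \<open>x has denominator dividing m!, and expanding that fraction represents x
      exactly with a denominator beyond m.\<close>
    define a where "a = fact m * (m + 1)"
    have "1 * (m + 1) \<le> a" unfolding a_def by (intro mult_right_mono) auto
    have xa: "x * real a = real_of_int (b * int (m + 1))" using b by (simp add: a_def algebra_simps)
    have "\<bar>real_of_int (b * int (m + 1))\<bar> \<le> real_of_int (K * int a)"
      unfolding xa[symmetric] using K by (simp add: abs_mult mult_right_mono)
    then have "\<bar>b * int (m + 1)\<bar> \<le> K * int a" by (simp only: of_int_abs[symmetric] of_int_le_iff)
    moreover have "x - real_of_int (b * int (m + 1)) / real a = 0"
      unfolding xa[symmetric] using \<open>1 * (m + 1) \<le> a\<close> by simp
    ultimately show ?thesis using \<open>1 * (m + 1) \<le> a\<close>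
      by (intro exI[of _ a] conjI CollectI exI[of _ "b * int (m + 1)"]) auto
  next
    case False
    \<comment> \<open>Every fraction with denominator below m stays at least \<epsilon> / m! away
      from x, so a large q must produce a larger denominator.\<close>
    then obtain \<epsilon> where \<epsilon>: "\<epsilon> > 0" "\<And>z. z \<in> \<int> \<Longrightarrow> \<epsilon> \<le> \<bar>real (fact m) * x - z\<bar>"
    proof -
      have "(\<int> :: real set) \<noteq> {}" using Ints_0 by blast
      then have "infdist (real (fact m) * x) \<int> > 0"
        using infdist_pos_not_in_closed[OF closed_Ints _ False] by blast
      then show ?thesis using that infdist_le[of _ \<int> "real (fact m) * x"] by (auto simp: dist_real_def)
    qed
    have "(\<lambda>q. real q powr - ((1 + l) / 2)) \<longlonglongrightarrow> 0"
      using l by (intro tendsto_neg_powr filterlim_real_sequentially) auto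
    then have "\<forall>\<^sub>F q in sequentially. real q powr - ((1 + l) / 2) < \<epsilon> / fact m / 2"
      by (rule order_tendstoD(2)) (use \<epsilon>(1) in simp)
    then have "\<forall>\<^sub>F q in sequentially. 2 * real q powr - ((1 + l) / 2) < \<epsilon> / fact m"
      by eventually_elim simp
    then obtain N where N: "\<And>q. q \<ge> N \<Longrightarrow> 2 * real q powr - ((1 + l) / 2) < \<epsilon> / fact m"
      unfolding eventually_sequentially by blast
    obtain q p1 p2 p3 where q: "q \<ge> N" "q > 0" "good_approx x l (int q) p1 p2 p3" "disc (int q, p1, p2, p3) = 0"
      using inf unfolding infinite_nat_iff_unbounded_le by blast
    obtain a and b :: int where a: "a \<in> ?S" and ab: "\<bar>x - b / a\<bar> \<le> 2 * real q powr - ((1 + l) / 2)"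
      using approx[OF q(2-4)] by blast
    have "m \<le> a"
    proof (rule ccontr)
      assume "\<not> m \<le> a"
      then have "a dvd fact m" using a by (intro dvd_fact) auto
      then obtain c where c: "fact m = a * c" by blast
      have "\<epsilon> \<le> \<bar>real (fact m) * x - of_int (int c * b)\<bar>" by (intro \<epsilon>(2)) simp
      also have "real (fact m) * x - of_int (int c * b) = fact m * (x - b / a)"
      proof -
        have "fact m * (b / a) = real c * b"
          using a by (simp add: c[THEN arg_cong[where f = real], simplified])
        then show ?thesis by (simp add: right_diff_distrib)
      qed
      also have "\<bar>\<dots>\<bar> = fact m * \<bar>x - b / a\<bar>" by (simp add: abs_mult)
      also have "\<dots> \<le> fact m * (2 * real q powr - ((1 + l) / 2))" using ab by (intro mult_left_mono) auto
      also have "\<dots> < fact m * (\<epsilon> / fact m)" using N[OF q(1)] by (intro mult_strict_left_mono) auto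
      finally show False by simp
    qed
    then show ?thesis using a by blast
  qed
  then show ?thesis
    unfolding rational_limsup_def w_def[symmetric] infinite_nat_iff_unbounded_le by blast
qed

text \<open>The union over n removes the bound K on |x|. The two families meet at one threshold,
  since s w > 2 and s (1 + l) > 2 - 2 l are equivalent.\<close>

lemma hausdorff_null_S_set:
  assumes l: "1/2 \<le> l" "l \<le> 2/3" and s: "(2 - 2 * l) / (1 + l) < s"
  shows "hausdorff_null s (S_set 3 I l)"
proof -
  define w where "w = (1 + l) / (1 - l)"
  have s1: "2 - 2 * l < s * (1 + l)" using s l by (simp add: divide_less_eq)
  have "0 < (2 - 2 * l) / (1 + l)" using l by simp
  then have "s > 0" using s by linarith
  have sw: "2 < s * w" using s1 l by (simp add: w_def less_divide_eq algebra_simps)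
  have "S_set 3 I l \<subseteq> (\<Union>n::nat. near_limsup (int n) l \<union> rational_limsup (int n) w)"
  proof
    fix x assume "x \<in> S_set 3 I l"
    then have inf: "infinite {q::nat. q > 0 \<and> (\<exists>p1 p2 p3. good_approx x l (int q) p1 p2 p3)}"
      using infinite_good_approx[OF l(1)] by (simp add: S_set_def)
    define K where "K = nat (\<lceil>\<bar>x\<bar>\<rceil> + 2)"
    have K: "\<bar>x\<bar> + 2 \<le> real_of_int (int K)" unfolding K_def by linarith
    have "{q::nat. q > 0 \<and> (\<exists>p1 p2 p3. good_approx x l (int q) p1 p2 p3)} \<subseteq>
      {q::nat. q > 0 \<and> (\<exists>p1 p2 p3. good_approx x l (int q) p1 p2 p3 \<and> disc (int q, p1, p2, p3) \<noteq> 0)} \<union>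
      {q::nat. q > 0 \<and> (\<exists>p1 p2 p3. good_approx x l (int q) p1 p2 p3 \<and> disc (int q, p1, p2, p3) = 0)}" by blast
    then have "infinite {q::nat. q > 0 \<and> (\<exists>p1 p2 p3. good_approx x l (int q) p1 p2 p3 \<and> disc (int q, p1, p2, p3) \<noteq> 0)} \<or>
      infinite {q::nat. q > 0 \<and> (\<exists>p1 p2 p3. good_approx x l (int q) p1 p2 p3 \<and> disc (int q, p1, p2, p3) = 0)}"
      using inf finite_subset unfolding finite_Un[symmetric] de_Morgan_conj[symmetric] by blast
    then have "x \<in> near_limsup (int K) l \<or> x \<in> rational_limsup (int K) w"
    proof
      assume "infinite {q::nat. q > 0 \<and> (\<exists>p1 p2 p3. good_approx x l (int q) p1 p2 p3 \<and> disc (int q, p1, p2, p3) \<noteq> 0)}"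
      then have "x \<in> near_limsup (int K) l" by (intro near_limsupI) (use l K in linarith)+
      then show ?thesis ..
    next
      assume "infinite {q::nat. q > 0 \<and> (\<exists>p1 p2 p3. good_approx x l (int q) p1 p2 p3 \<and> disc (int q, p1, p2, p3) = 0)}"
      then have "x \<in> rational_limsup (int K) w" unfolding w_def by (intro rational_limsupI) (use l K in linarith)+
      then show ?thesis ..
    qed
    then show "x \<in> (\<Union>n::nat. near_limsup (int n) l \<union> rational_limsup (int n) w)" by blast
  qed
  moreover have "hausdorff_null s (\<Union>n::nat. near_limsup (int n) l \<union> rational_limsup (int n) w)"
    using l s1 sw \<open>s > 0\<close>
    by (intro hausdorff_null_UN hausdorff_null_Un hausdorff_null_near_limsup hausdorff_null_rational_limsup) auto
  ultimately show ?thesis by (rule hausdorff_null_subset[rotated])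
qed

theorem theorem3:
  fixes I :: "real set" and l :: real
  assumes "open I" and "is_interval I" and "I \<noteq> {}"
    and "1/2 \<le> l" and "l \<le> 3/5"
  shows "hausdorff_dim (S_set 3 I l) \<le> ennreal ((4 - 2 * l) / (3 * (1 + l)))"
proof (rule hausdorff_dim_le)
  show "0 \<le> (4 - 2 * l) / (3 * (1 + l))" using assms by simp
  fix s assume s: "(4 - 2 * l) / (3 * (1 + l)) < s"
  have "(2 - 2 * l) / (1 + l) = (3 * (2 - 2 * l)) / (3 * (1 + l))"
    by (rule mult_divide_mult_cancel_left[symmetric]) simp
  \<comment> \<open>3 (2 - 2 l) <= 4 - 2 l amounts to l >= 1/2; at l = 1/2 both bounds equal
    2/3.\<close>
  also have "\<dots> \<le> (4 - 2 * l) / (3 * (1 + l))"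
    using assms by (intro divide_right_mono) auto
  finally have "(2 - 2 * l) / (1 + l) < s" using s by linarith
  then show "hausdorff_null s (S_set 3 I l)"
    using assms by (intro hausdorff_null_S_set) auto
qed

end
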